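(* Let $\mathcal{P}$ be a weakly connected and simple collection of cells of $\mathbb{Z}^2$, let $K$ be a field, and let $S=K[x_r : r\in V(\mathcal{P})]$. Let $I_{\mathcal{P}}\subset S$ be the ideal generated by all inner $2$-minors of $\mathcal{P}$, and let $J_{\mathcal{P}}\subset S$ be the toric ideal of the edge ring $K[G(\mathcal{P})]$ of the bipartite graph $G(\mathcal{P})$ associated to $\mathcal{P}$. Then $I_{\mathcal{P}}=J_{\mathcal{P}}$.
   Context: Order $\mathbb{Z}^2$ componentwise. For $a=(i,j)\le b=(k,l)$ the interval $[a,b]$ is $\{(r,s)\in\mathbb{Z}^2: i\le r\le k,\ j\le s\le l\}$. It is proper if $i<k$ and $j<l$; then $a,b$ are its diagonal corners and $c=(i,l)$, $d=(k,j)$ its anti-diagonal corners. A cell is an interval $C=[a,a+(1,1)]$; its vertex set $V(C)$ consists of its four points, and its edge set $E(C)$ consists of $\{a,a+(1,0)\}$, $\{a+(1,0),a+(1,1)\}$, $\{a+(0,1),a+(1,1)\}$, $\{a,a+(0,1)\}$. Collections of cells are non-empty and finite. For a collection $\mathcal{P}$ of cells, $V(\mathcal{P})=\bigcup_{C\in\mathcal{P}}V(C)$ and $E(\mathcal{P})=\bigcup_{C\in\mathcal{P}}E(C)$. $\mathcal{P}$ is weakly connected if for any two cells $C,D\in\mathcal{P}$ there are cells $C=C_1,\dots,C_m=D$ of $\mathcal{P}$ with $V(C_i)\cap V(C_{i+1})\ne\emptyset$ for $i=1,\dots,m-1$. A path of cells is a sequence $C_1,\dots,C_m$ of pairwise distinct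 cells of $\mathbb{Z}^2$ such that $C_i\cap C_{i+1}$ is a common edge of $C_i$ and $C_{i+1}$ for $i=1,\dots,m-1$. $\mathcal{P}$ is simple if any two cells of $\mathbb{Z}^2$ not in $\mathcal{P}$ are joined by a path of cells none of which is in $\mathcal{P}$. An inner interval of $\mathcal{P}$ is a proper interval $[a,b]$ such that all cells contained in $[a,b]$ belong to $\mathcal{P}$. The corresponding inner $2$-minor is $x_ax_b-x_cx_d$, where $c,d$ are the anti-diagonal corners of $[a,b]$. A horizontal edge interval of $\mathcal{P}$ is an interval $[(i,j),(k,j)]$ with $i<k$ such that $\{(\ell,j),(\ell+1,j)\}\in E(\mathcal{P})$ for all $\ell=i,\dots,k-1$; it is maximal if moreover $\{(i-1,j),(i,j)\}$ and $\{(k,j),(k+1,j)\}$ are not in $E(\mathcal{P})$. (Maximal) vertical edge intervals are defined similarly. Let $\{V_i\}_{i\in I}$ and $\{H_j\}_{j\in J}$ be the sets of maximal vertical, respectively maximal horizontal, edge intervals of $\mathcal{P}$, with associated variables $v_i$ ($i\in I$) and $h_j$ ($j\in J$). The bipartite graph $G(\mathcal{P})$ has vertex set $\{v_i\}_{i\in I}\sqcup\{h_j\}_{j\in J}$, and $\{v_i,h_j\}$ is an edge if and only if $V_i$ and $H_j$ meet in a vertex of $\mathcal{P}$. Define $\alpha: V(\mathcal{P})\to K[v_i,h_j : i\in I, j\in J]$ by $\alpha(r)=v_ih_j$, where $V_i$ and $H_j$ are the maximal vertical and horizontal edge intervals containing $r$. The edge ring is $K[G(\mathcal{P})]=K[\alpha(r):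 r\in V(\mathcal{P})]$, and $J_{\mathcal{P}}$ is the kernel of the surjective $K$-algebra homomorphism $\phi:S\to K[G(\mathcal{P})]$, $\phi(x_r)=\alpha(r)$. *)

theory Defs
  imports
    "HOL-Library.Poly_Mapping"
    "HOL-Library.Product_Order"
    "HOL-Algebra.Ideal"
    "HOL-Algebra.RingHom"
    "HOL-Algebra.Generated_Rings"
begin

section \<open>Collections of cells\<close>

text \<open>
  With the componentwise order of \<^theory>\<open>HOL-Library.Product_Order\<close>, the interval $[a,b]$ of
  $\mathbb{Z}^2$ is \<open>{a..b}\<close>.  A cell is the set of its four points, so a cell coincides with its
  own vertex set.
\<close>

type_synonym point = "int \<times> int"

definition cell :: "point \<Rightarrow> point set" where
  "cell a = {a..a + (1, 1)}"

definition cells :: "point set set" where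
  "cells = range cell"

definition cell_edges :: "point set \<Rightarrow> point set set" where
  "cell_edges C =
    (\<Union>a \<in> {a. C = cell a}.
      {{a, a + (1, 0)}, {a + (1, 0), a + (1, 1)}, {a + (0, 1), a + (1, 1)}, {a, a + (0, 1)}})"

definition cell_collection :: "point set set \<Rightarrow> bool" where
  "cell_collection P \<longleftrightarrow> P \<noteq> {} \<and> finite P \<and> P \<subseteq> cells"

definition vertices :: "point set set \<Rightarrow> point set" where
  "vertices P = \<Union>P"

definition edges :: "point set set \<Rightarrow> point set set" where
  "edges P = (\<Union>C\<in>P. cell_edges C)"

definition weakly_connected :: "point set set \<Rightarrow> bool" where
  "weakly_connected P \<longleftrightarrow>
    (\<forall>C\<in>P. \<forall>D\<in>P. \<exists>cs. cs \<noteq> [] \<and> hd cs = C \<and> last cs = D \<and> set cs \<subseteq> P \<and>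
      successively (\<lambda>A B. A \<inter> B \<noteq> {}) cs)"

definition path_of_cells :: "point set list \<Rightarrow> bool" where
  "path_of_cells cs \<longleftrightarrow>
    cs \<noteq> [] \<and> set cs \<subseteq> cells \<and> distinct cs \<and>
    successively (\<lambda>A B. A \<inter> B \<in> cell_edges A \<inter> cell_edges B) cs"

definition simple_collection :: "point set set \<Rightarrow> bool" where
  "simple_collection P \<longleftrightarrow>
    (\<forall>C \<in> cells - P. \<forall>D \<in> cells - P.
      \<exists>cs. path_of_cells cs \<and> hd cs = C \<and> last cs = D \<and> set cs \<inter> P = {})"

definition proper_interval :: "point \<Rightarrow> point \<Rightarrow> bool" where
  "proper_interval a b \<longleftrightarrow> fst a < fst b \<and> snd a < snd b"

definition inner_interval :: "point set set \<Rightarrow> point \<Rightarrow> point \<Rightarrow> bool" where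
  "inner_interval P a b \<longleftrightarrow> proper_interval a b \<and> (\<forall>C\<in>cells. C \<subseteq> {a..b} \<longrightarrow> C \<in> P)"

definition max_horizontal :: "point set set \<Rightarrow> point set set" where
  "max_horizontal P = {{(i, j)..(k, j)} | i j k. i < k \<and>
    (\<forall>l\<in>{i..k - 1}. {(l, j), (l + 1, j)} \<in> edges P) \<and>
    {(i - 1, j), (i, j)} \<notin> edges P \<and> {(k, j), (k + 1, j)} \<notin> edges P}"

definition max_vertical :: "point set set \<Rightarrow> point set set" where
  "max_vertical P = {{(j, i)..(j, k)} | i j k. i < k \<and>
    (\<forall>l\<in>{i..k - 1}. {(j, l), (j, l + 1)} \<in> edges P) \<and>
    {(j, i - 1), (j, i)} \<notin> edges P \<and> {(j, k), (j, k + 1)} \<notin> edges P}"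

text \<open>
  The graph $G(\mathcal{P})$.  Its vertices, which are also the variables of the ambient ring of the
  edge ring, are indexed by the edge intervals themselves: \<open>Inl V\<close> is $v_i$ for $V = V_i$, and
  \<open>Inr H\<close> is $h_j$ for $H = H_j$.
\<close>

type_synonym gvertex = "point set + point set"

definition graph_vertices :: "point set set \<Rightarrow> gvertex set" where
  "graph_vertices P = max_vertical P <+> max_horizontal P"

definition graph_edges :: "point set set \<Rightarrow> gvertex set set" where
  "graph_edges P = {{Inl V, Inr H} | V H.
    V \<in> max_vertical P \<and> H \<in> max_horizontal P \<and> V \<inter> H \<inter> vertices P \<noteq> {}}"


section \<open>Polynomial rings\<close>

text \<open>
  A polynomial with variables in \<open>'x\<close> is a finitely supported map from monomials (finitely supported
  exponent functions) to coefficients.  The type provides a variable for every element of \<open>'x\<close>;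
  \<open>mpoly_ring X\<close> is the polynomial ring $K[x : x \in X]$ in the variables from \<open>X\<close> only.
\<close>

type_synonym ('x, 'k) mpoly = "('x \<Rightarrow>\<^sub>0 nat) \<Rightarrow>\<^sub>0 'k"

definition Var :: "'x \<Rightarrow> ('x, 'k::field) mpoly" where
  "Var x = Poly_Mapping.single (Poly_Mapping.single x 1) 1"

definition Const :: "'k::field \<Rightarrow> ('x, 'k) mpoly" where
  "Const c = Poly_Mapping.single 0 c"

definition mpoly_ring :: "'x set \<Rightarrow> ('x, 'k::field) mpoly ring" where
  "mpoly_ring X =
    \<lparr>carrier = {p. \<forall>m \<in> Poly_Mapping.keys p. Poly_Mapping.keys m \<subseteq> X},
     mult = (*), one = 1, zero = 0, add = (+)\<rparr>"

text \<open>The $K$-algebra homomorphism sending each variable \<open>x\<close> to \<open>f x\<close>.\<close>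

definition mpoly_hom :: "('x \<Rightarrow> ('y, 'k) mpoly) \<Rightarrow> ('x, 'k::field) mpoly \<Rightarrow> ('y, 'k) mpoly" where
  "mpoly_hom f p =
    (\<Sum>m \<in> Poly_Mapping.keys p. Const (Poly_Mapping.lookup p m) *
      (\<Prod>x \<in> Poly_Mapping.keys m. f x ^ Poly_Mapping.lookup m x))"

lemma mpoly_hom_Var: "mpoly_hom f (Var x) = f x"
  by (simp add: mpoly_hom_def Var_def Const_def)

lemma mpoly_hom_Const: "mpoly_hom f (Const c) = Const c"
  by (simp add: mpoly_hom_def Const_def)

definition gen_subalgebra :: "'x set \<Rightarrow> ('x, 'k::field) mpoly set \<Rightarrow> ('x, 'k) mpoly ring" where
  "gen_subalgebra X A =
    (mpoly_ring X) \<lparr>carrier := generate_ring (mpoly_ring X) (range Const \<union> A)\<rparr>"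


section \<open>The two ideals\<close>

definition inner_minors :: "point set set \<Rightarrow> (point, 'k::field) mpoly set" where
  "inner_minors P =
    {Var (i, j) * Var (k, l) - Var (i, l) * Var (k, j) | i j k l. inner_interval P (i, j) (k, l)}"

definition inner_minor_ideal :: "point set set \<Rightarrow> (point, 'k::field) mpoly set" where
  "inner_minor_ideal P = genideal (mpoly_ring (vertices P)) (inner_minors P)"

text \<open>
  For a finite collection, the maximal edge intervals of either kind through a vertex exist and are
  unique, see \<open>ex1_max_vertical\<close> and \<open>ex1_max_horizontal\<close> below.
\<close>

definition alpha :: "point set set \<Rightarrow> point \<Rightarrow> (gvertex, 'k::field) mpoly" where
  "alpha P r =
    Var (Inl (THE V. V \<in> max_vertical P \<and> r \<in> V)) *
    Var (Inr (THE H. H \<in> max_horizontal P \<and> r \<in> H))"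

definition edge_ring :: "point set set \<Rightarrow> (gvertex, 'k::field) mpoly ring" where
  "edge_ring P = gen_subalgebra (graph_vertices P) (alpha P ` vertices P)"

definition toric_ideal :: "point set set \<Rightarrow> (point, 'k::field) mpoly set" where
  "toric_ideal P = a_kernel (mpoly_ring (vertices P)) (edge_ring P) (mpoly_hom (alpha P))"


section \<open>Maximal edge intervals through a vertex\<close>

lemma cell_eq: "cell (i, j) = {(i, j), (i + 1, j), (i, j + 1), (i + 1, j + 1)}"
  by (auto simp: cell_def less_eq_prod_def)

lemma cell_inject [simp]: "cell a = cell b \<longleftrightarrow> a = b"
proof
  assume "cell a = cell b"
  moreover have "a \<in> cell a" "b \<in> cell b"
    by (auto simp: cell_def less_eq_prod_def)
  ultimately have "a \<le> b" "b \<le> a"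
    by (auto simp: cell_def)
  then show "a = b" by simp
qed simp

lemma cell_edges_cell: "cell_edges (cell (i, j)) =
    {{(i, j), (i + 1, j)}, {(i + 1, j), (i + 1, j + 1)},
     {(i, j + 1), (i + 1, j + 1)}, {(i, j), (i, j + 1)}}"
  by (auto simp: cell_edges_def)

lemma finite_edges:
  assumes "cell_collection P"
  shows "finite (edges P)"
proof -
  have "finite (cell_edges C)" if "C \<in> P" for C
  proof -
    from that assms obtain i j where "C = cell (i, j)"
      by (force simp: cell_collection_def cells_def)
    then show ?thesis by (simp add: cell_edges_cell)
  qed
  with assms show ?thesis by (auto simp: edges_def cell_collection_def)
qed

lemma edges_subset_vertices:
  assumes "cell_collection P" "e \<in> edges P"
  shows "e \<subseteq> vertices P"
proof -
  from assms obtain i j where ij: "cell (i, j) \<in> P" "e \<in> cell_edges (cell (i, j))"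
    by (force simp: edges_def cell_collection_def cells_def)
  have "e \<subseteq> cell (i, j)"
    using ij(2)[unfolded cell_edges_cell] unfolding cell_eq by auto
  with \<open>cell (i, j) \<in> P\<close> show ?thesis by (auto simp: vertices_def)
qed

lemma vertex_edges:
  assumes "cell_collection P" "(x, y) \<in> vertices P"
  shows "{(x, y), (x + 1, y)} \<in> edges P \<or> {(x - 1, y), (x, y)} \<in> edges P"
    and "{(x, y), (x, y + 1)} \<in> edges P \<or> {(x, y - 1), (x, y)} \<in> edges P"
proof -
  from assms obtain i j where ij: "cell (i, j) \<in> P" "(x, y) \<in> cell (i, j)"
    by (force simp: vertices_def cell_collection_def cells_def)
  have sub: "cell_edges (cell (i, j)) \<subseteq> edges P" using ij by (auto simp: edges_def)
  from ij(2) have "x = i \<or> x = i + 1" "y = j \<or> y = j + 1"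
    by (auto simp: cell_eq)
  then show "{(x, y), (x + 1, y)} \<in> edges P \<or> {(x - 1, y), (x, y)} \<in> edges P"
    and "{(x, y), (x, y + 1)} \<in> edges P \<or> {(x, y - 1), (x, y)} \<in> edges P"
    using sub by (auto simp: cell_edges_cell)
qed

lemma maximal_run:
  fixes T :: "int set"
  assumes "finite T" "x \<in> T"
  obtains i k where "i \<le> x" "x < k" "{i..k - 1} \<subseteq> T" "i - 1 \<notin> T" "k \<notin> T"
proof -
  have "\<exists>n. x + int n \<notin> T"
  proof (rule ccontr)
    assume "\<not> ?thesis"
    then have "(\<lambda>n. x + int n) ` UNIV \<subseteq> T" by auto
    moreover have "inj (\<lambda>n. x + int n)" by (auto simp: inj_on_def)
    ultimately show False
      using assms(1) finite_imageD finite_subset infinite_UNIV_nat by blast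
  qed
  define n where "n = (LEAST n. x + int n \<notin> T)"
  have n: "x + int n \<notin> T" "\<And>m. m < n \<Longrightarrow> x + int m \<in> T"
    unfolding n_def using LeastI_ex[OF \<open>\<exists>n. x + int n \<notin> T\<close>] not_less_Least by blast+
  have "\<exists>n. x - int n \<notin> T"
  proof (rule ccontr)
    assume "\<not> ?thesis"
    then have "(\<lambda>n. x - int n) ` UNIV \<subseteq> T" by auto
    moreover have "inj (\<lambda>n. x - int n)" by (auto simp: inj_on_def)
    ultimately show False
      using assms(1) finite_imageD finite_subset infinite_UNIV_nat by blast
  qed
  define q where "q = (LEAST n. x - int n \<notin> T)"
  have q: "x - int q \<notin> T" "\<And>m. m < q \<Longrightarrow> x - int m \<in> T"
    unfolding q_def using LeastI_ex[OF \<open>\<exists>n. x - int n \<notin> T\<close>] not_less_Least by blast+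
  have pos: "n > 0" "q > 0" using n(1) q(1) assms(2) by (auto intro!: Nat.gr0I)
  have "l \<in> T" if "x - int q + 1 \<le> l" "l \<le> x + int n - 1" for l
  proof (cases "l \<le> x")
    case True
    then show ?thesis using q(2)[of "nat (x - l)"] that by auto
  next
    case False
    then show ?thesis using n(2)[of "nat (l - x)"] that by auto
  qed
  then have "{x - int q + 1..x + int n - 1} \<subseteq> T" by auto
  moreover have "x - int q + 1 - 1 \<notin> T" using q(1) by simp
  moreover have "x - int q + 1 \<le> x" "x < x + int n" using pos by auto
  ultimately show thesis using that n(1) by blast
qed

lemma ex1_max_horizontal:
  assumes P: "cell_collection P" and r: "r \<in> vertices P"
  shows "\<exists>!H. H \<in> max_horizontal P \<and> r \<in> H"
proof -
  obtain x y where xy: "r = (x, y)" by fastforce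
  define T where "T = {l. {(l, y), (l + 1, y)} \<in> edges P}"
  have "inj_on (\<lambda>l. {(l, y), (l + 1, y)}) T"
    by (auto simp: inj_on_def doubleton_eq_iff)
  moreover have "finite ((\<lambda>l. {(l, y), (l + 1, y)}) ` T)"
    by (rule finite_subset[OF _ finite_edges[OF P]]) (auto simp: T_def)
  ultimately have "finite T" by (rule finite_imageD[rotated])
  have "x \<in> T \<or> x - 1 \<in> T" using vertex_edges(1)[OF P] r xy by (auto simp: T_def)
  then obtain x' where x': "x' \<in> T" "x' \<le> x" "x \<le> x' + 1" by force
  obtain i k where ik': "i \<le> x'" "x' < k" and run: "{i..k - 1} \<subseteq> T" "i - 1 \<notin> T" "k \<notin> T"
    using maximal_run[OF \<open>finite T\<close> x'(1)] .
  have ik: "i \<le> x" "x \<le> k" "i < k" using ik' x' by auto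
  have "{(i, y)..(k, y)} \<in> max_horizontal P"
    unfolding max_horizontal_def
    by (rule CollectI, rule exI[of _ i], rule exI[of _ y], rule exI[of _ k])
      (use ik run in \<open>auto simp: T_def\<close>)
  moreover have "r \<in> {(i, y)..(k, y)}" using ik xy by simp
  moreover have "H = {(i, y)..(k, y)}" if H: "H \<in> max_horizontal P" "r \<in> H" for H
  proof -
    from H(1) obtain i' j' k' where 1: "H = {(i', j')..(k', j')}" "i' < k'"
      "\<forall>l\<in>{i'..k' - 1}. {(l, j'), (l + 1, j')} \<in> edges P"
      "{(i' - 1, j'), (i', j')} \<notin> edges P" "{(k', j'), (k' + 1, j')} \<notin> edges P"
      by (auto simp: max_horizontal_def)
    from H(2) 1(1) xy have 2: "j' = y" "i' \<le> x" "x \<le> k'" by auto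
    have 3: "{i'..k' - 1} \<subseteq> T" "i' - 1 \<notin> T" "k' \<notin> T"
      using 1 2 by (auto simp: T_def)
    have "i' - 1 \<in> T" if "i < i'" using subsetD[OF run(1), of "i' - 1"] ik 2 that by simp
    moreover have "i - 1 \<in> T" if "i' < i" using subsetD[OF 3(1), of "i - 1"] ik 2 that by simp
    moreover have "k \<in> T" if "k < k'" using subsetD[OF 3(1), of k] ik 2 that by simp
    moreover have "k' \<in> T" if "k' < k" using subsetD[OF run(1), of k'] ik 2 that by simp
    ultimately have "i = i'" "k = k'" using run 3 by (meson linorder_cases)+
    then show ?thesis using 1(1) 2(1) by simp
  qed
  ultimately show ?thesis by blast
qed

lemma ex1_max_vertical:
  assumes P: "cell_collection P" and r: "r \<in> vertices P"
  shows "\<exists>!V. V \<in> max_vertical P \<and> r \<in> V"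
proof -
  obtain x y where xy: "r = (y, x)" by fastforce
  define T where "T = {l. {(y, l), (y, l + 1)} \<in> edges P}"
  have "inj_on (\<lambda>l. {(y, l), (y, l + 1)}) T"
    by (auto simp: inj_on_def doubleton_eq_iff)
  moreover have "finite ((\<lambda>l. {(y, l), (y, l + 1)}) ` T)"
    by (rule finite_subset[OF _ finite_edges[OF P]]) (auto simp: T_def)
  ultimately have "finite T" by (rule finite_imageD[rotated])
  have "x \<in> T \<or> x - 1 \<in> T" using vertex_edges(2)[OF P] r xy by (auto simp: T_def)
  then obtain x' where x': "x' \<in> T" "x' \<le> x" "x \<le> x' + 1" by force
  obtain i k where ik': "i \<le> x'" "x' < k" and run: "{i..k - 1} \<subseteq> T" "i - 1 \<notin> T" "k \<notin> T"
    using maximal_run[OF \<open>finite T\<close> x'(1)] .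
  have ik: "i \<le> x" "x \<le> k" "i < k" using ik' x' by auto
  have "{(y, i)..(y, k)} \<in> max_vertical P"
    unfolding max_vertical_def
    by (rule CollectI, rule exI[of _ i], rule exI[of _ y], rule exI[of _ k])
      (use ik run in \<open>auto simp: T_def\<close>)
  moreover have "r \<in> {(y, i)..(y, k)}" using ik xy by simp
  moreover have "V = {(y, i)..(y, k)}" if V: "V \<in> max_vertical P" "r \<in> V" for V
  proof -
    from V(1) obtain i' j' k' where 1: "V = {(j', i')..(j', k')}" "i' < k'"
      "\<forall>l\<in>{i'..k' - 1}. {(j', l), (j', l + 1)} \<in> edges P"
      "{(j', i' - 1), (j', i')} \<notin> edges P" "{(j', k'), (j', k' + 1)} \<notin> edges P"
      by (auto simp: max_vertical_def)
    from V(2) 1(1) xy have 2: "j' = y" "i' \<le> x" "x \<le> k'" by auto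
    have 3: "{i'..k' - 1} \<subseteq> T" "i' - 1 \<notin> T" "k' \<notin> T"
      using 1 2 by (auto simp: T_def)
    have "i' - 1 \<in> T" if "i < i'" using subsetD[OF run(1), of "i' - 1"] ik 2 that by simp
    moreover have "i - 1 \<in> T" if "i' < i" using subsetD[OF 3(1), of "i - 1"] ik 2 that by simp
    moreover have "k \<in> T" if "k < k'" using subsetD[OF 3(1), of k] ik 2 that by simp
    moreover have "k' \<in> T" if "k' < k" using subsetD[OF run(1), of k'] ik 2 that by simp
    ultimately have "i = i'" "k = k'" using run 3 by (meson linorder_cases)+
    then show ?thesis using 1(1) 2(1) by simp
  qed
  ultimately show ?thesis by blast
qed

text \<open>
  The generators \<open>alpha P r\<close> of the edge ring are exactly the edge monomials of $G(\mathcal{P})$.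
\<close>

lemma alpha_image_vertices:
  assumes P: "cell_collection P"
  shows "alpha P ` vertices P =
    ((\<lambda>e. \<Prod>w\<in>e. Var w) ` graph_edges P :: (gvertex, 'k::field) mpoly set)"
proof -
  have *: "alpha P r = (\<Prod>w\<in>{Inl V, Inr H}. Var w :: (gvertex, 'k) mpoly)"
    if "r \<in> vertices P" "V \<in> max_vertical P" "r \<in> V" "H \<in> max_horizontal P" "r \<in> H" for r V H
  proof -
    have "(THE V. V \<in> max_vertical P \<and> r \<in> V) = V"
      using ex1_max_vertical[OF P that(1)] that by (intro the1_equality) auto
    moreover have "(THE H. H \<in> max_horizontal P \<and> r \<in> H) = H"
      using ex1_max_horizontal[OF P that(1)] that by (intro the1_equality) auto
    ultimately show ?thesis by (simp add: alpha_def)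
  qed
  show ?thesis
  proof (intro equalityI subsetI)
    fix p :: "(gvertex, 'k) mpoly"
    assume "p \<in> alpha P ` vertices P"
    then obtain r where r: "r \<in> vertices P" "p = alpha P r" by blast
    obtain V where V: "V \<in> max_vertical P" "r \<in> V" using ex1_max_vertical[OF P r(1)] by blast
    obtain H where H: "H \<in> max_horizontal P" "r \<in> H" using ex1_max_horizontal[OF P r(1)] by blast
    have "{Inl V, Inr H} \<in> graph_edges P"
      using r(1) V H by (auto simp: graph_edges_def)
    with *[OF r(1) V H] r(2) show "p \<in> (\<lambda>e. \<Prod>w\<in>e. Var w) ` graph_edges P" by blast
  next
    fix p :: "(gvertex, 'k) mpoly"
    assume "p \<in> (\<lambda>e. \<Prod>w\<in>e. Var w) ` graph_edges P"
    then obtain e where e: "e \<in> graph_edges P" "p = (\<Prod>w\<in>e. Var w)" by blast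
    from e(1) obtain V H r where "e = {Inl V, Inr H}" "V \<in> max_vertical P"
      "H \<in> max_horizontal P" "r \<in> V" "r \<in> H" "r \<in> vertices P"
      unfolding graph_edges_def by blast
    with * e(2) show "p \<in> alpha P ` vertices P" by (metis image_eqI)
  qed
qed

end

theory Submission
  imports Defs
begin

text \<open>
  Regard a vertex \<open>r\<close> of the collection as the edge of the bipartite graph that joins the maximal
  vertical interval \<open>ver P r\<close> to the maximal horizontal interval \<open>hor P r\<close>.  The opposite sides of an
  inner interval lie in common edge intervals, so every inner minor is in the toric ideal.  For the
  converse, the toric ideal is spanned by the differences of monomials with the same image, and one has
  to see that such monomials are congruent modulo the inner minors (\<open>mono_cong_of_equal_image\<close>).

  Two monomials with the same image are multisets of edges with the same degrees.  Walking
  alternately along the edges of one and of the other, one finds a cycle, and it suffices to exchange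
  its two halves \<open>u\<close> and \<open>v\<close> modulo the inner minors, by induction on the degree.  The induction rests on
  two facts.

  First, a chord of the cycle splits it into two shorter cycles, and the exchanges along these two
  compose to the exchange along the whole cycle (\<open>balanced_chord\<close>, \<open>mono_cong_chord\<close>).

  Second, the cycle is a closed rectilinear curve along edges of the collection.  Its winding number
  does not change across an edge that is not in the collection.  As the collection is simple, every
  cell outside is joined to infinity across such edges, so the winding number vanishes outside
  (\<open>winding_outside\<close>).  Above the bottom side that starts at the lowest, leftmost corner of the curve,
  the winding number is not zero, and it remains constant up to the first row in which an interval of the
  curve reaches into the strip above this side.  The rectangle swept out is therefore an inner
  interval, and its upper side lies on an interval of the curve (\<open>inner_rectangle_at_lowest_corner\<close>).
  An upper corner of this rectangle either is a chord or belongs to the cycle; if neither is a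
  chord, then the rectangle itself is a cycle of length four, and its inner minor performs
  the exchange.
\<close>

section \<open>Balanced pairs and alternating cycles\<close>

text \<open>
  Think of an element \<open>x\<close> as the edge joining \<open>V x\<close> to \<open>H x\<close> in a bipartite graph.  Then a balanced
  pair is a disjoint union of even cycles whose edges are taken alternately from \<open>u\<close> and from \<open>v\<close>
  (an element common to both sets is a degenerate cycle of length two).  This form is symmetric in
  \<open>u\<close> and \<open>v\<close> and needs no cyclic enumeration of the edges.
\<close>

definition balanced :: "('a \<Rightarrow> 'v) \<Rightarrow> ('a \<Rightarrow> 'h) \<Rightarrow> 'a set \<Rightarrow> 'a set \<Rightarrow> bool" where
  "balanced V H u v \<longleftrightarrow> finite u \<and> finite v \<and>
    inj_on V u \<and> inj_on V v \<and> V ` u = V ` v \<and>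
    inj_on H u \<and> inj_on H v \<and> H ` u = H ` v"

lemma balanced_sym: "balanced V H u v \<Longrightarrow> balanced V H v u"
  by (auto simp: balanced_def)

lemma balanced_card: "balanced V H u v \<Longrightarrow> card u = card v"
  by (metis balanced_def card_image)

lemma balanced_singleton: "balanced V H {c} {c}"
  by (simp add: balanced_def)

lemma balanced_diff:
  assumes "balanced V H u v" "balanced V H A B" "A \<subseteq> u" "B \<subseteq> v"
  shows "balanced V H (u - A) (v - B)"
proof -
  have "V ` (u - A) = V ` u - V ` A" "V ` (v - B) = V ` v - V ` B"
    "H ` (u - A) = H ` u - H ` A" "H ` (v - B) = H ` v - H ` B"
    using assms by (simp_all add: balanced_def inj_on_image_set_diff[OF _ Diff_subset])
  with assms show ?thesis by (auto simp: balanced_def intro: inj_on_subset)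
qed

text \<open>
  Walking from an edge of \<open>u\<close> to the edge of \<open>v\<close> with the same \<open>H\<close>, and on to the edge of \<open>u\<close> with
  the same \<open>V\<close>, permutes \<open>u\<close>.  Starting at \<open>p\<close>, the walk either comes back without having met \<open>s\<close>,
  and then it has traced a cycle that is not all of \<open>u\<close>, or it meets \<open>s\<close>.  In the second case the
  part traced up to \<open>s\<close> is a path; its edges in \<open>v\<close> miss exactly the two ends \<open>V p\<close> and \<open>H s\<close>.
\<close>

lemma balanced_cycle_or_path:
  assumes bal: "balanced V H u v" and "p \<in> u" "s \<in> u"
  obtains (cycle) A B where "A \<subseteq> u" "A \<noteq> {}" "A \<noteq> u" "B \<subseteq> v" "balanced V H A B"
    | (path) A B where "A \<subseteq> u" "p \<in> A" "s \<in> A" "B \<subseteq> v"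
        "V ` B = V ` (A - {p})" "H ` B = H ` (A - {s})"
proof -
  have fin: "finite u" "finite v" and inj: "inj_on V u" "inj_on V v" "inj_on H u" "inj_on H v"
    and img: "V ` u = V ` v" "H ` u = H ` v"
    using bal by (auto simp: balanced_def)
  have "\<exists>f. \<forall>e\<in>u. f e \<in> v \<and> H (f e) = H e"
    using img(2) by (intro bchoice) (metis imageE imageI)
  then obtain f where f: "\<And>e. e \<in> u \<Longrightarrow> f e \<in> v" "\<And>e. e \<in> u \<Longrightarrow> H (f e) = H e" by blast
  have "\<exists>g. \<forall>e\<in>v. g e \<in> u \<and> V (g e) = V e"
    using img(1) by (intro bchoice) (metis imageE imageI)
  then obtain g where g: "\<And>e. e \<in> v \<Longrightarrow> g e \<in> u" "\<And>e. e \<in> v \<Longrightarrow> V (g e) = V e" by blast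
  define t where "t = g \<circ> f"
  have t_in: "t e \<in> u" if "e \<in> u" for e using f g that by (simp add: t_def)
  have t_V: "V (t e) = V (f e)" if "e \<in> u" for e using f g that by (simp add: t_def)
  have "inj_on f u" using f(2) inj(3) by (metis inj_on_def)
  moreover have "inj_on g v" using g(2) inj(2) by (metis inj_on_def)
  ultimately have inj_t: "inj_on t u"
    unfolding t_def by (intro comp_inj_on) (use f(1) in \<open>auto intro: inj_on_subset\<close>)
  \<comment> \<open>The part of the orbit of \<open>p\<close> up to the first visit of \<open>s\<close>, as a least fixed point.\<close>
  define A where "A = lfp (\<lambda>Z. insert p (t ` (Z - {s})))"
  have "mono (\<lambda>Z. insert p (t ` (Z - {s})))" by (intro monoI) blast
  then have A_eq: "A = insert p (t ` (A - {s}))" unfolding A_def by (rule lfp_unfold)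
  have A_sub: "A \<subseteq> u" unfolding A_def
    by (rule lfp_lowerbound) (use t_in \<open>p \<in> u\<close> in auto)
  have pA: "p \<in> A" using A_eq by blast
  have finA: "finite A" using A_sub fin(1) finite_subset by blast
  have tV: "V ` f ` Z = V ` t ` Z" and fH: "H ` f ` Z = H ` Z" if "Z \<subseteq> u" for Z
    unfolding image_image by (intro image_cong refl; use t_V f(2) that in auto)+
  show thesis
  proof (cases "s \<in> A")
    case False
    then have "A = insert p (t ` A)" using A_eq by simp
    then have "t ` A \<subseteq> A" by blast
    then have tA: "t ` A = A"
      by (metis A_sub card_image card_subset_eq finA inj_on_subset inj_t)
    have "balanced V H A (f ` A)"
      unfolding balanced_def
      using finA A_sub inj f(1) tV[OF A_sub] fH[OF A_sub] tA
      by (auto intro: inj_on_subset simp: image_subset_iff subset_iff)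
    moreover have "A \<noteq> u" using False \<open>s \<in> u\<close> by blast
    ultimately show thesis using cycle[of A "f ` A"] A_sub pA f(1) by blast
  next
    case True
    have "card (t ` (A - {s})) = card A - 1"
      using True finA A_sub inj_t by (metis card_Diff_singleton card_image Diff_subset inj_on_subset)
    moreover have "card A > 0" using pA finA card_gt_0_iff by blast
    \<comment> \<open>The image has one element fewer than \<open>A\<close>, so \<open>p\<close> must account for the missing one.\<close>
    ultimately have "p \<notin> t ` (A - {s})"
      using A_eq by (metis diff_less insert_absorb less_irrefl less_one)
    then have "t ` (A - {s}) = A - {p}" using A_eq by blast
    moreover have "A - {s} \<subseteq> u" using A_sub by blast
    ultimately show thesis
      using path[of A "f ` (A - {s})"] A_sub pA True f(1) tV[of "A - {s}"] fH[of "A - {s}"] by auto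
  qed
qed

text \<open>
  An edge \<open>r\<close> outside a cycle that joins two of its nodes is a chord: it closes each of the two arcs
  between these nodes to a shorter cycle.  The arc from \<open>V r\<close> to \<open>H r\<close> that begins and ends in \<open>u\<close>
  takes \<open>r\<close> on the side of \<open>v\<close>; the other arc takes it on the side of \<open>u\<close>.  If the two nodes lie on
  different cycles, then one of these cycles splits off instead.
\<close>

lemma balanced_chord:
  assumes bal: "balanced V H u v" and "V r \<in> V ` u" "H r \<in> H ` u" "r \<notin> u" "r \<notin> v"
    and pair_inj: "inj_on (\<lambda>x. (V x, H x)) (insert r (u \<union> v))"
  obtains (cycle) A B where "A \<subseteq> u" "A \<noteq> {}" "A \<noteq> u" "B \<subseteq> v" "balanced V H A B"
    | (split) A B where "A \<subseteq> u" "A \<noteq> u" "B \<subseteq> v"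
        "balanced V H A (insert r B)" "balanced V H (insert r (u - A)) (v - B)"
        "card (insert r (u - A)) < card u"
proof -
  have fin: "finite u" "finite v" and inj: "inj_on V u" "inj_on V v" "inj_on H u" "inj_on H v"
    and img: "V ` u = V ` v" "H ` u = H ` v"
    using bal by (auto simp: balanced_def)
  have joint: "x = r" if "x \<in> u \<union> v" "V x = V r" "H x = H r" for x
    using inj_onD[OF pair_inj, of x r] that by simp
  from assms(2) obtain p where p: "p \<in> u" "V p = V r" by force
  from assms(3) obtain s where s: "s \<in> u" "H s = H r" by force
  note ps = p s
  have "p \<noteq> s" using ps joint[of p] \<open>r \<notin> u\<close> by auto
  from bal \<open>p \<in> u\<close> \<open>s \<in> u\<close> show thesis
  proof (cases rule: balanced_cycle_or_path)
    case cycle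
    then show thesis using that(1) by blast
  next
    case (path A B)
    note AB = path
    have finA: "finite A" and finB: "finite B" using AB(1,4) fin finite_subset by blast+
    have subs: "inj_on V A" "inj_on H A" "inj_on V B" "inj_on H B"
      using inj_on_subset[OF inj(1) AB(1)] inj_on_subset[OF inj(3) AB(1)]
        inj_on_subset[OF inj(2) AB(4)] inj_on_subset[OF inj(4) AB(4)] by simp_all
    have VA: "V r \<in> V ` A" and HA: "H r \<in> H ` A" using AB(2,3) ps by (metis imageI)+
    have "r \<notin> B" using AB(4) \<open>r \<notin> v\<close> by blast
    have VB: "V ` B = V ` A - {V r}"
      using AB(2,5) subs(1) ps(2) by (simp add: inj_on_image_set_diff)
    have HB: "H ` B = H ` A - {H r}"
      using AB(3,6) subs(2) ps(4) by (simp add: inj_on_image_set_diff)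
    have "V ` insert r B = V ` A" "H ` insert r B = H ` A"
      using VA HA by (simp_all add: VB HB insert_absorb)
    moreover have "inj_on V (insert r B)" "inj_on H (insert r B)"
      using subs(3,4) \<open>r \<notin> B\<close> by (simp_all add: inj_on_insert VB HB)
    ultimately have 1: "balanced V H A (insert r B)"
      using finA finB subs by (simp add: balanced_def)
    have Vd: "V ` (u - A) = V ` u - V ` A" "V ` (v - B) = V ` u - (V ` A - {V r})"
      using inj_on_image_set_diff[OF inj(1), of u A] inj_on_image_set_diff[OF inj(2), of v B]
        AB(1,4) img(1) VB by simp_all
    have Hd: "H ` (u - A) = H ` u - H ` A" "H ` (v - B) = H ` u - (H ` A - {H r})"
      using inj_on_image_set_diff[OF inj(3), of u A] inj_on_image_set_diff[OF inj(4), of v B]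
        AB(1,4) img(2) HB by simp_all
    have "V ` insert r (u - A) = V ` (v - B)" "H ` insert r (u - A) = H ` (v - B)"
      unfolding image_insert Vd Hd using assms(2,3) by blast+
    moreover have "inj_on V (insert r (u - A))"
      using inj_on_subset[OF inj(1), of "u - A"] VA \<open>r \<notin> u\<close> by (simp add: inj_on_insert Vd(1))
    moreover have "inj_on H (insert r (u - A))"
      using inj_on_subset[OF inj(3), of "u - A"] HA \<open>r \<notin> u\<close> by (simp add: inj_on_insert Hd(1))
    moreover have "inj_on V (u - A)" "inj_on H (u - A)" "inj_on V (v - B)" "inj_on H (v - B)"
      using inj by (simp_all add: inj_on_diff)
    ultimately have 2: "balanced V H (insert r (u - A)) (v - B)"
      using fin by (simp add: balanced_def)
    \<comment> \<open>If the path used up \<open>u\<close>, then the only edge left in \<open>v\<close> would be parallel to \<open>r\<close>.\<close>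
    have "A \<noteq> u"
    proof
      assume "A = u"
      then have "card (v - B) = 1" using balanced_card[OF 2] by simp
      then obtain x where x: "v - B = {x}" using card_1_singletonE by blast
      with 2 \<open>A = u\<close> have "V x = V r" "H x = H r" by (auto simp: balanced_def)
      then show False using joint[of x] x \<open>r \<notin> v\<close> by auto
    qed
    have "card {p, s} \<le> card A" using finA AB(2,3) by (intro card_mono) auto
    then have "2 \<le> card A" using \<open>p \<noteq> s\<close> by simp
    moreover have "card A \<le> card u" using AB(1) fin(1) by (rule card_mono[rotated])
    ultimately have "card (insert r (u - A)) < card u"
      using AB(1) fin(1) finA \<open>r \<notin> u\<close> by (simp add: card_Diff_subset)
    then show thesis by (rule that(2)[OF AB(1) \<open>A \<noteq> u\<close> AB(4) 1 2])
  qed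
qed

text \<open>
  In a finite bipartite graph one can walk forever, alternating between edges of \<open>u\<close> and of \<open>v\<close>, and
  so one ends up in a cycle.  Choosing the successor of an edge as a function of the node that the
  walk has reached makes the walk injective on nodes once it is periodic.
\<close>

lemma balanced_subsets_of_equal_images:
  assumes fin: "finite u" "finite v" and ne: "u \<noteq> {}"
    and H: "H ` u \<subseteq> H ` v" and V: "V ` v \<subseteq> V ` u"
  obtains A B where "A \<subseteq> u" "A \<noteq> {}" "B \<subseteq> v" "balanced V H A B"
proof -
  define f where "f = inv_into v H \<circ> H"
  define g where "g = inv_into u V \<circ> V"
  define t where "t = g \<circ> f"
  have f: "f e \<in> v" "H (f e) = H e" if "e \<in> u" for e
    using H that by (auto simp: f_def inv_into_into f_inv_into_f subset_iff)
  have g: "g e \<in> u" "V (g e) = V e" if "e \<in> v" for e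
    using V that by (auto simp: g_def inv_into_into f_inv_into_f subset_iff)
  define Q where "Q A \<longleftrightarrow> A \<subseteq> u \<and> A \<noteq> {} \<and> t ` A \<subseteq> A" for A
  have "Q u" using ne f g by (auto simp: Q_def t_def)
  \<comment> \<open>On a smallest non-empty set closed under the walk \<open>t\<close>, the walk is a permutation.\<close>
  then obtain A where A: "Q A" "\<And>Z. Q Z \<Longrightarrow> card A \<le> card Z"
    using ex_has_least_nat[of Q u card] by blast
  have finA: "finite A" using A fin finite_subset by (auto simp: Q_def)
  have "Q (t ` A)" using A(1) by (auto simp: Q_def)
  then have "card (t ` A) = card A" using A(2) card_image_le[OF finA, of t] by fastforce
  then have inj_t: "inj_on t A" using finA by (rule eq_card_imp_inj_on[rotated])
  have tA: "t ` A = A" using A(1) finA \<open>card (t ` A) = card A\<close> by (simp add: Q_def card_subset_eq)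
  have sub: "A \<subseteq> u" using A by (simp add: Q_def)
  have VfA: "V (t e) = V (f e)" if "e \<in> A" for e
    using f g sub that by (auto simp: t_def)
  have "V ` f ` A = V ` t ` A" using VfA by (auto simp: image_image)
  then have "V ` f ` A = V ` A" using tA by simp
  moreover have "H ` f ` A = H ` A" using f sub by (auto simp: image_image subset_iff)
  moreover have "inj_on H A"
    using inj_t by (auto simp: inj_on_def t_def f_def)
  moreover have "inj_on V (f ` A)"
    using inj_t by (auto simp: inj_on_def t_def g_def)
  moreover have "inj_on H (f ` A)"
    using f sub \<open>inj_on H A\<close> by (auto simp: inj_on_def subset_iff)
  moreover have "card (V ` A) = card A"
  proof -
    have "card (f ` A) = card A" using inj_t finA
      by (metis card_image inj_on_imageI2 t_def)
    then show ?thesis using \<open>V ` f ` A = V ` A\<close> \<open>inj_on V (f ` A)\<close> by (metis card_image)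
  qed
  then have "inj_on V A" using finA by (rule eq_card_imp_inj_on[rotated])
  ultimately have "balanced V H A (f ` A)" using finA by (simp add: balanced_def)
  then show thesis using that[of A "f ` A"] A(1) f by (auto simp: Q_def)
qed

section \<open>Maximal edge intervals and inner intervals\<close>

text \<open>
  For a vertex \<open>r\<close> these are the intervals \<open>H\<^sub>j\<close> and \<open>V\<^sub>i\<close> in the definition of \<open>\<alpha>(r)\<close>.
\<close>

definition hor :: "point set set \<Rightarrow> point \<Rightarrow> point set" where
  "hor P r = (THE H. H \<in> max_horizontal P \<and> r \<in> H)"

definition ver :: "point set set \<Rightarrow> point \<Rightarrow> point set" where
  "ver P r = (THE V. V \<in> max_vertical P \<and> r \<in> V)"

lemma hor_mem:
  assumes "cell_collection P" "r \<in> vertices P"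
  shows "hor P r \<in> max_horizontal P" "r \<in> hor P r"
  using theI'[OF ex1_max_horizontal[OF assms]] by (auto simp: hor_def)

lemma ver_mem:
  assumes "cell_collection P" "r \<in> vertices P"
  shows "ver P r \<in> max_vertical P" "r \<in> ver P r"
  using theI'[OF ex1_max_vertical[OF assms]] by (auto simp: ver_def)

lemma hor_eqI:
  assumes "cell_collection P" "r \<in> vertices P" "H \<in> max_horizontal P" "r \<in> H"
  shows "hor P r = H"
  unfolding hor_def using assms(3,4) by (intro the1_equality ex1_max_horizontal[OF assms(1,2)]) simp

lemma ver_eqI:
  assumes "cell_collection P" "r \<in> vertices P" "V \<in> max_vertical P" "r \<in> V"
  shows "ver P r = V"
  unfolding ver_def using assms(3,4) by (intro the1_equality ex1_max_vertical[OF assms(1,2)]) simp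

lemma max_horizontal_same_row:
  assumes "H \<in> max_horizontal P" "r \<in> H" "s \<in> H"
  shows "snd r = snd s"
  using assms by (auto simp: max_horizontal_def less_eq_prod_def)

lemma max_vertical_same_column:
  assumes "V \<in> max_vertical P" "r \<in> V" "s \<in> V"
  shows "fst r = fst s"
  using assms by (auto simp: max_vertical_def less_eq_prod_def)

lemma max_horizontal_convex:
  assumes "H \<in> max_horizontal P" "(x, y) \<in> H" "(x', y') \<in> H" "x \<le> z" "z \<le> x'"
  shows "(z, y) \<in> H"
  using assms by (auto simp: max_horizontal_def less_eq_prod_def)

lemma max_vertical_convex:
  assumes "V \<in> max_vertical P" "(x, y) \<in> V" "(x', y') \<in> V" "y \<le> z" "z \<le> y'"
  shows "(x, z) \<in> V"
  using assms by (auto simp: max_vertical_def less_eq_prod_def)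

lemma max_horizontal_edge:
  assumes "H \<in> max_horizontal P" "(x, y) \<in> H" "(x + 1, y) \<in> H"
  shows "{(x, y), (x + 1, y)} \<in> edges P"
  using assms by (force simp: max_horizontal_def less_eq_prod_def)

lemma max_vertical_edge:
  assumes "V \<in> max_vertical P" "(x, y) \<in> V" "(x, y + 1) \<in> V"
  shows "{(x, y), (x, y + 1)} \<in> edges P"
  using assms by (force simp: max_vertical_def less_eq_prod_def)

lemma max_horizontal_subset_vertices:
  assumes P: "cell_collection P" and H: "H \<in> max_horizontal P"
  shows "H \<subseteq> vertices P"
proof
  fix r assume "r \<in> H"
  obtain i j k where *: "H = {(i, j)..(k, j)}" "i < k"
    "\<And>l. i \<le> l \<Longrightarrow> l \<le> k - 1 \<Longrightarrow> {(l, j), (l + 1, j)} \<in> edges P"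
    using H by (auto simp: max_horizontal_def)
  obtain x where x: "r = (x, j)" "i \<le> x" "x \<le> k"
    using \<open>r \<in> H\<close> *(1) by (cases r) (auto simp: less_eq_prod_def)
  show "r \<in> vertices P"
    using *(3)[of x] *(3)[of "x - 1"] edges_subset_vertices[OF P] x *(2)
    by (cases "x = k") force+
qed

lemma hor_step:
  assumes P: "cell_collection P" and e: "{(x, y), (x + 1, y)} \<in> edges P"
  shows "hor P (x, y) = hor P (x + 1, y)"
proof -
  have v: "(x, y) \<in> vertices P" "(x + 1, y) \<in> vertices P"
    using edges_subset_vertices[OF P e] by auto
  obtain i j k where *: "hor P (x, y) = {(i, j)..(k, j)}" "{(k, j), (k + 1, j)} \<notin> edges P"
    using hor_mem(1)[OF P v(1)] unfolding max_horizontal_def by blast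
  have "(x, y) \<in> {(i, j)..(k, j)}" using hor_mem(2)[OF P v(1)] * by simp
  moreover from this have "x \<noteq> k" using *(2) e by auto
  ultimately have "(x + 1, y) \<in> hor P (x, y)" using *(1) by simp
  then show ?thesis using hor_eqI[OF P v(2)] hor_mem(1)[OF P v(1)] by metis
qed

lemma ver_step:
  assumes P: "cell_collection P" and e: "{(x, y), (x, y + 1)} \<in> edges P"
  shows "ver P (x, y) = ver P (x, y + 1)"
proof -
  have v: "(x, y) \<in> vertices P" "(x, y + 1) \<in> vertices P"
    using edges_subset_vertices[OF P e] by auto
  obtain i j k where *: "ver P (x, y) = {(j, i)..(j, k)}" "{(j, k), (j, k + 1)} \<notin> edges P"
    using ver_mem(1)[OF P v(1)] unfolding max_vertical_def by blast
  have "(x, y) \<in> {(j, i)..(j, k)}" using ver_mem(2)[OF P v(1)] * by simp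
  moreover from this have "y \<noteq> k" using *(2) e by auto
  ultimately have "(x, y + 1) \<in> ver P (x, y)" using *(1) by simp
  then show ?thesis using ver_eqI[OF P v(2)] ver_mem(1)[OF P v(1)] by metis
qed

lemma hor_run:
  assumes P: "cell_collection P" and "x \<le> x'"
    and "\<And>z. x \<le> z \<Longrightarrow> z < x' \<Longrightarrow> {(z, y), (z + 1, y)} \<in> edges P"
  shows "hor P (x, y) = hor P (x', y)"
  using assms(2,3)
proof (induction x' rule: int_ge_induct)
  case (step z)
  then show ?case using hor_step[OF P, of z y] by simp
qed simp

lemma ver_run:
  assumes P: "cell_collection P" and "y \<le> y'"
    and "\<And>z. y \<le> z \<Longrightarrow> z < y' \<Longrightarrow> {(x, z), (x, z + 1)} \<in> edges P"
  shows "ver P (x, y) = ver P (x, y')"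
  using assms(2,3)
proof (induction y' rule: int_ge_induct)
  case (step z)
  then show ?case using ver_step[OF P, of x z] by simp
qed simp

text \<open>
  A column and a row meet in one point, so the graph of the collection has no multiple edges, and a
  vertex of the collection can be identified with the edge of the graph that it gives.
\<close>

lemma inj_on_ver_hor:
  assumes P: "cell_collection P"
  shows "inj_on (\<lambda>r. (ver P r, hor P r)) (vertices P)"
proof (rule inj_onI)
  fix r s assume rs: "r \<in> vertices P" "s \<in> vertices P" and "(ver P r, hor P r) = (ver P s, hor P s)"
  then have eq: "ver P r = ver P s" "hor P r = hor P s" by simp_all
  show "r = s"
    using max_vertical_same_column[OF ver_mem[OF P rs(1)], of s] ver_mem(2)[OF P rs(2)]
      max_horizontal_same_row[OF hor_mem[OF P rs(1)], of s] hor_mem(2)[OF P rs(2)] eq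
    by (simp add: prod_eq_iff)
qed

lemma horizontal_edges_eq_iff:
  "{(x, y), (x + 1, y)} = {(a, b), (a + 1, b)} \<longleftrightarrow> (a, b) = (x, y)" for a b x y :: int
  unfolding doubleton_eq_iff prod.inject by linarith

lemma vertical_edges_eq_iff:
  "{(x, y), (x, y + 1)} = {(a, b), (a, b + 1)} \<longleftrightarrow> (a, b) = (x, y)" for a b x y :: int
  unfolding doubleton_eq_iff prod.inject by linarith

lemma horizontal_edge_neq_vertical_edge:
  "{(x, y), (x + 1, y)} \<noteq> {(a, b), (a, b + 1)}" for a b x y :: int
  unfolding doubleton_eq_iff prod.inject by linarith

lemma horizontal_edge_of_cell_iff:
  "{(x, y), (x + 1, y)} \<in> cell_edges (cell c) \<longleftrightarrow> c = (x, y) \<or> c = (x, y - 1)"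
proof (cases c)
  case (Pair a b)
  show ?thesis
    by (simp only: Pair cell_edges_cell insert_iff empty_iff horizontal_edges_eq_iff
        horizontal_edge_neq_vertical_edge prod.inject simp_thms) linarith
qed

lemma vertical_edge_of_cell_iff:
  "{(x, y), (x, y + 1)} \<in> cell_edges (cell c) \<longleftrightarrow> c = (x, y) \<or> c = (x - 1, y)"
proof (cases c)
  case (Pair a b)
  show ?thesis
    by (simp only: Pair cell_edges_cell insert_iff empty_iff vertical_edges_eq_iff
        horizontal_edge_neq_vertical_edge[symmetric] prod.inject simp_thms) linarith
qed

lemma horizontal_edge_iff:
  assumes "cell_collection P"
  shows "{(x, y), (x + 1, y)} \<in> edges P \<longleftrightarrow> cell (x, y) \<in> P \<or> cell (x, y - 1) \<in> P"
proof -
  have "{(x, y), (x + 1, y)} \<in> edges P \<longleftrightarrow>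
      (\<exists>c. cell c \<in> P \<and> {(x, y), (x + 1, y)} \<in> cell_edges (cell c))"
    using assms unfolding edges_def cell_collection_def cells_def by blast
  then show ?thesis unfolding horizontal_edge_of_cell_iff by blast
qed

lemma vertical_edge_iff:
  assumes "cell_collection P"
  shows "{(x, y), (x, y + 1)} \<in> edges P \<longleftrightarrow> cell (x, y) \<in> P \<or> cell (x - 1, y) \<in> P"
proof -
  have "{(x, y), (x, y + 1)} \<in> edges P \<longleftrightarrow>
      (\<exists>c. cell c \<in> P \<and> {(x, y), (x, y + 1)} \<in> cell_edges (cell c))"
    using assms unfolding edges_def cell_collection_def cells_def by blast
  then show ?thesis unfolding vertical_edge_of_cell_iff by blast
qed

lemma cell_subset_interval_iff:
  "cell (x, y) \<subseteq> {(i, j)..(k, l)} \<longleftrightarrow> i \<le> x \<and> x < k \<and> j \<le> y \<and> y < l"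
  by (auto simp: cell_eq less_eq_prod_def)

lemma inner_interval_iff:
  "inner_interval P (i, j) (k, l) \<longleftrightarrow>
    i < k \<and> j < l \<and> (\<forall>x y. i \<le> x \<and> x < k \<and> j \<le> y \<and> y < l \<longrightarrow> cell (x, y) \<in> P)"
  by (auto simp: inner_interval_def proper_interval_def cells_def cell_subset_interval_iff)

text \<open>
  Each side of an inner interval runs along edges of its cells, so it lies in one maximal edge
  interval.  Hence the two terms of an inner minor have the same image under \<open>\<alpha>\<close>.
\<close>

lemma inner_interval_corners:
  assumes P: "cell_collection P" and I: "inner_interval P (i, j) (k, l)"
  shows "{(i, j), (k, l), (i, l), (k, j)} \<subseteq> vertices P"
    and "ver P (i, l) = ver P (i, j)" "ver P (k, l) = ver P (k, j)"
    and "hor P (k, j) = hor P (i, j)" "hor P (k, l) = hor P (i, l)"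
proof -
  have ij: "i < k" "j < l" and
    C: "\<And>x y. i \<le> x \<Longrightarrow> x < k \<Longrightarrow> j \<le> y \<Longrightarrow> y < l \<Longrightarrow> cell (x, y) \<in> P"
    using I by (auto simp: inner_interval_iff)
  have *: "c \<in> vertices P" if "c \<in> cell (x, y)" "i \<le> x" "x < k" "j \<le> y" "y < l" for c x y
    using C[of x y] that by (auto simp: vertices_def)
  show "{(i, j), (k, l), (i, l), (k, j)} \<subseteq> vertices P"
    using *[of "(i, j)" i j] *[of "(k, l)" "k - 1" "l - 1"] *[of "(i, l)" i "l - 1"]
      *[of "(k, j)" "k - 1" j] ij by (simp add: cell_eq)
  show "ver P (i, l) = ver P (i, j)"
    using ij C by (intro ver_run[OF P, symmetric]) (auto simp: vertical_edge_iff[OF P])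
  show "ver P (k, l) = ver P (k, j)"
    using ij C[of "k - 1"] by (intro ver_run[OF P, symmetric]) (auto simp: vertical_edge_iff[OF P])
  show "hor P (k, j) = hor P (i, j)"
    using ij C by (intro hor_run[OF P, symmetric]) (auto simp: horizontal_edge_iff[OF P])
  show "hor P (k, l) = hor P (i, l)"
    using ij C[of _ "l - 1"] by (intro hor_run[OF P, symmetric]) (auto simp: horizontal_edge_iff[OF P])
qed

section \<open>Winding numbers and inner rectangles\<close>

text \<open>
  Join each point of \<open>u\<close> to the point of \<open>v\<close> with the same horizontal and to the one with the same
  vertical edge interval.  For a balanced pair this gives closed rectilinear curves, which turn at the
  points of \<open>u\<close> and \<open>v\<close>.  Up to the choice of orientation, \<open>winding u v z\<close> is their winding number
  around the cell with lower left corner \<open>z\<close>.  The formula, which counts in the quadrant below and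
  to the left of \<open>z\<close>, makes no reference to the curves.
\<close>

definition winding :: "point set \<Rightarrow> point set \<Rightarrow> point \<Rightarrow> int" where
  "winding u v z = int (card {e \<in> u. e \<le> z}) - int (card {e \<in> v. e \<le> z})"

lemma card_quadrant_row:
  fixes u :: "point set"
  assumes "finite u"
  shows "card {e \<in> u. e \<le> (x, y)} = card {e \<in> u. e \<le> (x, y - 1)} + card {e \<in> u. snd e = y \<and> fst e \<le> x}"
proof -
  have "{e \<in> u. e \<le> (x, y)} = {e \<in> u. e \<le> (x, y - 1)} \<union> {e \<in> u. snd e = y \<and> fst e \<le> x}"
    by (auto simp: less_eq_prod_def)
  moreover have "{e \<in> u. e \<le> (x, y - 1)} \<inter> {e \<in> u. snd e = y \<and> fst e \<le> x} = {}"
    by (auto simp: less_eq_prod_def)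
  ultimately show ?thesis using assms by (simp add: card_Un_disjoint)
qed

lemma card_quadrant_column:
  fixes u :: "point set"
  assumes "finite u"
  shows "card {e \<in> u. e \<le> (x, y)} = card {e \<in> u. e \<le> (x - 1, y)} + card {e \<in> u. fst e = x \<and> snd e \<le> y}"
proof -
  have "{e \<in> u. e \<le> (x, y)} = {e \<in> u. e \<le> (x - 1, y)} \<union> {e \<in> u. fst e = x \<and> snd e \<le> y}"
    by (auto simp: less_eq_prod_def)
  moreover have "{e \<in> u. e \<le> (x - 1, y)} \<inter> {e \<in> u. fst e = x \<and> snd e \<le> y} = {}"
    by (auto simp: less_eq_prod_def)
  ultimately show ?thesis using assms by (simp add: card_Un_disjoint)
qed

lemma card_eq_of_inj_images:
  "f ` A = f ` B \<Longrightarrow> inj_on f A \<Longrightarrow> inj_on f B \<Longrightarrow> card A = card B"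
  by (metis card_image)

text \<open>
  If no edge interval of the curve crosses the line between the columns \<open>x\<close> and \<open>x + 1\<close> in row \<open>y\<close>, then
  the points of \<open>u\<close> and \<open>v\<close> on a common interval in this row lie on the same side of that line.
\<close>

lemma hor_image_row_subset:
  assumes P: "cell_collection P" and "u \<subseteq> vertices P" "v \<subseteq> vertices P"
    and img: "hor P ` u = hor P ` v"
    and nox: "\<And>H. H \<in> hor P ` u \<Longrightarrow> (x, y) \<in> H \<Longrightarrow> (x + 1, y) \<notin> H"
  shows "hor P ` {e \<in> u. snd e = y \<and> fst e \<le> x} \<subseteq> hor P ` {e \<in> v. snd e = y \<and> fst e \<le> x}"
proof
  fix H assume "H \<in> hor P ` {e \<in> u. snd e = y \<and> fst e \<le> x}"
  then obtain a where a: "(a, y) \<in> u" "H = hor P (a, y)" "a \<le> x" by auto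
  then have "H \<in> hor P ` v" using img by blast
  then obtain f where f: "f \<in> v" "H = hor P f" by blast
  have H: "H \<in> max_horizontal P" "(a, y) \<in> H" using hor_mem[OF P, of "(a, y)"] a assms(2) by auto
  moreover have "f \<in> H" using hor_mem[OF P, of f] f assms(3) by auto
  ultimately have "snd f = y" using max_horizontal_same_row[of H P f "(a, y)"] by simp
  have "fst f \<le> x"
  proof (rule ccontr)
    assume "\<not> ?thesis"
    then have "(x, y) \<in> H" "(x + 1, y) \<in> H"
      using max_horizontal_convex[OF H, of "fst f" "snd f"] \<open>f \<in> H\<close> a(3) by auto
    moreover have "H \<in> hor P ` u" using a by blast
    ultimately show False using nox by blast
  qed
  then show "H \<in> hor P ` {e \<in> v. snd e = y \<and> fst e \<le> x}" using f \<open>snd f = y\<close> by blast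
qed

lemma ver_image_column_subset:
  assumes P: "cell_collection P" and "u \<subseteq> vertices P" "v \<subseteq> vertices P"
    and img: "ver P ` u = ver P ` v"
    and nox: "\<And>V. V \<in> ver P ` u \<Longrightarrow> (x, y) \<in> V \<Longrightarrow> (x, y + 1) \<notin> V"
  shows "ver P ` {e \<in> u. fst e = x \<and> snd e \<le> y} \<subseteq> ver P ` {e \<in> v. fst e = x \<and> snd e \<le> y}"
proof
  fix V assume "V \<in> ver P ` {e \<in> u. fst e = x \<and> snd e \<le> y}"
  then obtain a where a: "(x, a) \<in> u" "V = ver P (x, a)" "a \<le> y" by auto
  then have "V \<in> ver P ` v" using img by blast
  then obtain f where f: "f \<in> v" "V = ver P f" by blast
  have V: "V \<in> max_vertical P" "(x, a) \<in> V" using ver_mem[OF P, of "(x, a)"] a assms(2) by auto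
  moreover have "f \<in> V" using ver_mem[OF P, of f] f assms(3) by auto
  ultimately have "fst f = x" using max_vertical_same_column[of V P f "(x, a)"] by simp
  have "snd f \<le> y"
  proof (rule ccontr)
    assume "\<not> ?thesis"
    then have "(x, y) \<in> V" "(x, y + 1) \<in> V"
      using max_vertical_convex[OF V, of "fst f" "snd f"] \<open>f \<in> V\<close> a(3) by auto
    moreover have "V \<in> ver P ` u" using a by blast
    ultimately show False using nox by blast
  qed
  then show "V \<in> ver P ` {e \<in> v. fst e = x \<and> snd e \<le> y}" using f \<open>fst f = x\<close> by blast
qed

text \<open>
  The winding number can only change across the curve: the difference of the two values counts the
  points of \<open>u\<close> minus those of \<open>v\<close> in row \<open>y\<close> up to column \<open>x\<close>, and these are matched by their edge
  intervals unless one of the intervals continues to column \<open>x + 1\<close>.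
\<close>

lemma winding_across_horizontal_edge:
  assumes P: "cell_collection P" and sub: "u \<subseteq> vertices P" "v \<subseteq> vertices P"
    and bal: "balanced (ver P) (hor P) u v"
    and nox: "\<And>H. H \<in> hor P ` u \<Longrightarrow> (x, y) \<in> H \<Longrightarrow> (x + 1, y) \<notin> H"
  shows "winding u v (x, y) = winding u v (x, y - 1)"
proof -
  have img: "hor P ` u = hor P ` v" and fin: "finite u" "finite v"
    and inj: "inj_on (hor P) u" "inj_on (hor P) v"
    using bal by (auto simp: balanced_def)
  have nox': "\<And>H. H \<in> hor P ` v \<Longrightarrow> (x, y) \<in> H \<Longrightarrow> (x + 1, y) \<notin> H"
    using nox unfolding img .
  have "hor P ` {e \<in> u. snd e = y \<and> fst e \<le> x} = hor P ` {e \<in> v. snd e = y \<and> fst e \<le> x}"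
    by (rule subset_antisym[OF hor_image_row_subset[OF P sub img nox]
          hor_image_row_subset[OF P sub(2,1) img[symmetric] nox']])
  moreover have "inj_on (hor P) {e \<in> u. snd e = y \<and> fst e \<le> x}"
    "inj_on (hor P) {e \<in> v. snd e = y \<and> fst e \<le> x}"
    using inj by (auto intro: inj_on_subset)
  ultimately have "card {e \<in> u. snd e = y \<and> fst e \<le> x} = card {e \<in> v. snd e = y \<and> fst e \<le> x}"
    by (rule card_eq_of_inj_images)
  then show ?thesis
    unfolding winding_def card_quadrant_row[OF fin(1), of x y] card_quadrant_row[OF fin(2), of x y]
    by simp
qed

lemma winding_across_vertical_edge:
  assumes P: "cell_collection P" and sub: "u \<subseteq> vertices P" "v \<subseteq> vertices P"
    and bal: "balanced (ver P) (hor P) u v"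
    and nox: "\<And>V. V \<in> ver P ` u \<Longrightarrow> (x, y) \<in> V \<Longrightarrow> (x, y + 1) \<notin> V"
  shows "winding u v (x, y) = winding u v (x - 1, y)"
proof -
  have img: "ver P ` u = ver P ` v" and fin: "finite u" "finite v"
    and inj: "inj_on (ver P) u" "inj_on (ver P) v"
    using bal by (auto simp: balanced_def)
  have nox': "\<And>V. V \<in> ver P ` v \<Longrightarrow> (x, y) \<in> V \<Longrightarrow> (x, y + 1) \<notin> V"
    using nox unfolding img .
  have "ver P ` {e \<in> u. fst e = x \<and> snd e \<le> y} = ver P ` {e \<in> v. fst e = x \<and> snd e \<le> y}"
    by (rule subset_antisym[OF ver_image_column_subset[OF P sub img nox]
          ver_image_column_subset[OF P sub(2,1) img[symmetric] nox']])
  moreover have "inj_on (ver P) {e \<in> u. fst e = x \<and> snd e \<le> y}"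
    "inj_on (ver P) {e \<in> v. fst e = x \<and> snd e \<le> y}"
    using inj by (auto intro: inj_on_subset)
  ultimately have "card {e \<in> u. fst e = x \<and> snd e \<le> y} = card {e \<in> v. fst e = x \<and> snd e \<le> y}"
    by (rule card_eq_of_inj_images)
  then show ?thesis
    unfolding winding_def card_quadrant_column[OF fin(1), of x y] card_quadrant_column[OF fin(2), of x y]
    by simp
qed

text \<open>
  An edge belongs to no cells but the two that it separates, so an edge between two cells outside the
  collection is not an edge of the collection, and the curve does not run along it.
\<close>

lemma winding_adjacent_outside:
  assumes P: "cell_collection P" and sub: "u \<subseteq> vertices P" "v \<subseteq> vertices P"
    and bal: "balanced (ver P) (hor P) u v"
    and out: "cell a \<notin> P" "cell b \<notin> P"
    and adj: "cell a \<inter> cell b \<in> cell_edges (cell a) \<inter> cell_edges (cell b)"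
  shows "winding u v a = winding u v b"
proof -
  have h: "winding u v (x, y) = winding u v (x, y - 1)"
    if "cell (x, y) \<notin> P" "cell (x, y - 1) \<notin> P" for x y
  proof (rule winding_across_horizontal_edge[OF P sub bal])
    fix H assume "H \<in> hor P ` u" "(x, y) \<in> H"
    then show "(x + 1, y) \<notin> H"
      using that max_horizontal_edge[of H P x y] hor_mem(1)[OF P] sub(1)
      by (auto simp: horizontal_edge_iff[OF P])
  qed
  have v: "winding u v (x, y) = winding u v (x - 1, y)"
    if "cell (x, y) \<notin> P" "cell (x - 1, y) \<notin> P" for x y
  proof (rule winding_across_vertical_edge[OF P sub bal])
    fix V assume "V \<in> ver P ` u" "(x, y) \<in> V"
    then show "(x, y + 1) \<notin> V"
      using that max_vertical_edge[of V P x y] ver_mem(1)[OF P] sub(1)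
      by (auto simp: vertical_edge_iff[OF P])
  qed
  obtain e where e: "e \<in> cell_edges (cell a)" "e \<in> cell_edges (cell b)" using adj by blast
  obtain i j where a: "a = (i, j)" by fastforce
  from e(1) consider x y where "e = {(x, y), (x + 1, y)}" | x y where "e = {(x, y), (x, y + 1)}"
    unfolding a cell_edges_cell by blast
  then show ?thesis
  proof cases
    case (1 x y)
    then have "a = (x, y) \<or> a = (x, y - 1)" "b = (x, y) \<or> b = (x, y - 1)"
      using e by (simp_all add: horizontal_edge_of_cell_iff)
    then show ?thesis using h[of x y] out by auto
  next
    case (2 x y)
    then have "a = (x, y) \<or> a = (x - 1, y)" "b = (x, y) \<or> b = (x - 1, y)"
      using e by (simp_all add: vertical_edge_of_cell_iff)
    then show ?thesis using v[of x y] out by auto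
  qed
qed

lemma winding_along_path:
  assumes P: "cell_collection P" and sub: "u \<subseteq> vertices P" "v \<subseteq> vertices P"
    and bal: "balanced (ver P) (hor P) u v"
    and "successively (\<lambda>A B. A \<inter> B \<in> cell_edges A \<inter> cell_edges B) cs"
    and "cs \<noteq> []" "set cs \<subseteq> cells" "set cs \<inter> P = {}" "hd cs = cell a" "last cs = cell b"
  shows "winding u v a = winding u v b"
  using assms(5-)
proof (induction cs arbitrary: a rule: induct_list012)
  case (2 C)
  then have "cell a = cell b" by simp
  then show ?case by simp
next
  case (3 C D cs)
  from 3(5) obtain d where d: "D = cell d" by (auto simp: cells_def)
  have "C = cell a" using 3(7) by simp
  have "winding u v a = winding u v d"
    using 3(3,6) \<open>C = cell a\<close> d by (intro winding_adjacent_outside[OF P sub bal]) auto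
  also have "winding u v d = winding u v b"
    using 3(3,5,6,8) d by (intro 3(2)) auto
  finally show ?case .
qed simp

text \<open>
  This replaces the Jordan curve theorem, and it is where simplicity of the collection enters: a cell
  outside the collection is joined, outside the collection, to a cell to the left of all vertices,
  where the winding number is zero.
\<close>

lemma winding_outside:
  assumes P: "cell_collection P" and simple: "simple_collection P"
    and sub: "u \<subseteq> vertices P" "v \<subseteq> vertices P"
    and bal: "balanced (ver P) (hor P) u v"
    and out: "cell a \<notin> P"
  shows "winding u v a = 0"
proof -
  have "finite (cell c)" for c by (cases c) (simp add: cell_eq)
  then have "finite C" if "C \<in> P" for C
    using P that unfolding cell_collection_def cells_def by blast
  then have "finite (vertices P)"
    using P unfolding vertices_def cell_collection_def by (intro finite_Union) simp_all
  define x0 where "x0 = Min (insert 0 (fst ` vertices P)) - 1"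
  have "Min (insert 0 (fst ` vertices P)) \<le> fst z" if "z \<in> vertices P" for z
    using \<open>finite (vertices P)\<close> that by (intro Min_le) auto
  then have x0: "x0 < fst z" if "z \<in> vertices P" for z
    using that unfolding x0_def by fastforce
  have "cell (x0, 0) \<notin> P"
  proof
    assume "cell (x0, 0) \<in> P"
    then have "(x0, 0) \<in> vertices P" unfolding vertices_def by (auto simp: cell_eq)
    from x0[OF this] show False by simp
  qed
  then have "cell a \<in> cells - P" "cell (x0, 0) \<in> cells - P" using out by (simp_all add: cells_def)
  then obtain cs where "path_of_cells cs" "hd cs = cell a" "last cs = cell (x0, 0)" "set cs \<inter> P = {}"
    using simple[unfolded simple_collection_def] by meson
  then have "winding u v a = winding u v (x0, 0)"
    by (intro winding_along_path[OF P sub bal, of cs]) (simp_all add: path_of_cells_def)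
  also have "\<dots> = 0"
  proof -
    have "\<not> e \<le> (x0, 0)" if "e \<in> vertices P" for e
      using x0[OF that] by (simp add: less_eq_prod_def)
    then have "{e \<in> u. e \<le> (x0, 0)} = {}" "{e \<in> v. e \<le> (x0, 0)} = {}"
      using sub by blast+
    then show ?thesis by (simp only: winding_def)
  qed
  finally show ?thesis .
qed

text \<open>
  The cells on top of the bottom side from \<open>p = (a, j)\<close> to its partner \<open>(b, j)\<close> have winding number one.
  Going up between the columns \<open>a\<close> and \<open>b\<close>, the winding number stays one until, in some row \<open>h\<close>, an
  interval of the curve reaches into the strip.  All cells up to this row therefore belong to the
  collection, and they form an inner interval whose upper side lies on an interval of the curve.
\<close>

lemma inner_rectangle_at_lowest_corner:
  assumes P: "cell_collection P" and simple: "simple_collection P"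
    and sub: "u \<subseteq> vertices P" "v \<subseteq> vertices P"
    and bal: "balanced (ver P) (hor P) u v" and disj: "u \<inter> v = {}"
    and p: "(a, j) \<in> u"
    and low: "\<And>s. s \<in> u \<union> v \<Longrightarrow> j < snd s \<or> snd s = j \<and> a \<le> fst s"
  obtains b h where "(b, j) \<in> v" "inner_interval P (a, j) (b, h)" "hor P (a, h) \<in> hor P ` u"
proof -
  have img: "ver P ` u = ver P ` v" "hor P ` u = hor P ` v" and fin: "finite u" "finite v"
    and inj: "inj_on (hor P) u" "inj_on (hor P) v"
    using bal by (auto simp: balanced_def)
  define L where "L = hor P (a, j)"
  have pv: "(a, j) \<in> vertices P" using p sub by blast
  have L: "L \<in> max_horizontal P" "(a, j) \<in> L" using hor_mem[OF P pv] by (simp_all add: L_def)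
  have in_L: "hor P e = L" if "e \<in> u \<union> v" "e \<in> L" for e
    using hor_eqI[OF P _ L(1) that(2)] that(1) sub by blast
  have "L \<in> hor P ` v" unfolding L_def img(2)[symmetric] using p by (rule imageI)
  then obtain q where q: "q \<in> v" "hor P q = L" by blast
  have "q \<in> L" using hor_mem(2)[OF P, of q] q sub by auto
  obtain b where b: "q = (b, j)"
    using max_horizontal_same_row[OF L(1) \<open>q \<in> L\<close> L(2)] by (cases q) simp
  have "a \<le> b" using low[of q] q b by auto
  moreover have "a \<noteq> b" using p q disj b by blast
  ultimately have "a < b" by simp
  have wind_bottom: "winding u v (x, j) = 1" if "a \<le> x" "x < b" for x
  proof -
    have only: "e \<in> L \<and> fst e \<le> x" if "e \<in> u \<union> v" "e \<le> (x, j)" for e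
    proof -
      have "snd e = j" "a \<le> fst e" "fst e \<le> x"
        using low[OF that(1)] that(2) by (auto simp: less_eq_prod_def)
      moreover from this have "(fst e, j) \<in> L"
        using max_horizontal_convex[OF L, of b j "fst e"] \<open>q \<in> L\<close> b \<open>x < b\<close> by simp
      ultimately show ?thesis by (cases e) simp
    qed
    have "{e \<in> u. e \<le> (x, j)} = {(a, j)}"
    proof
      show "{e \<in> u. e \<le> (x, j)} \<subseteq> {(a, j)}"
      proof
        fix e assume "e \<in> {e \<in> u. e \<le> (x, j)}"
        then have e: "e \<in> u" "e \<in> L" using only[of e] by blast+
        then have "hor P e = hor P (a, j)" using in_L[of e] by (simp add: L_def)
        then show "e \<in> {(a, j)}" using inj_onD[OF inj(1)] e(1) p by simp
      qed
      show "{(a, j)} \<subseteq> {e \<in> u. e \<le> (x, j)}" using p \<open>a \<le> x\<close> by (simp add: less_eq_prod_def)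
    qed
    moreover have "{e \<in> v. e \<le> (x, j)} = {}"
    proof -
      have "False" if "e \<in> v" "e \<le> (x, j)" for e
      proof -
        have "e \<in> L" "fst e \<le> x" using only that by blast+
        then have "hor P e = hor P q" using in_L q that(1) by simp
        then have "e = q" using inj_onD[OF inj(2)] that(1) q(1) by simp
        then show False using \<open>fst e \<le> x\<close> \<open>x < b\<close> b by simp
      qed
      then show ?thesis by blast
    qed
    ultimately show ?thesis by (simp only: winding_def) simp
  qed
  \<comment> \<open>Some row above \<open>j\<close> is hit, because the vertical partner of \<open>(a, j)\<close> lies in column \<open>a\<close>.\<close>
  define hit where "hit y \<longleftrightarrow> (\<exists>H\<in>hor P ` u. \<exists>x. a \<le> x \<and> x \<le> b \<and> (x, y) \<in> H)" for y
  obtain h1 where h1: "hit h1" "j < h1"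
  proof -
    have "ver P (a, j) \<in> ver P ` v" unfolding img(1)[symmetric] using p by (rule imageI)
    then obtain p' where p': "p' \<in> v" "ver P p' = ver P (a, j)" by force
    then have "p' \<in> ver P (a, j)" using ver_mem(2)[OF P, of p'] sub by auto
    then have "fst p' = a"
      using max_vertical_same_column[OF ver_mem(1)[OF P pv] _ ver_mem(2)[OF P pv], of p'] by simp
    then obtain h1 where h1: "p' = (a, h1)" by (cases p') simp
    have "h1 \<noteq> j" using p p'(1) disj h1 by blast
    then have "j < h1" using low[of p'] p' h1 by auto
    have "hor P p' \<in> hor P ` u" unfolding img(2) using p'(1) by (rule imageI)
    moreover have "p' \<in> hor P p'" using p'(1) hor_mem(2)[OF P, of p'] sub by auto
    ultimately have "hit h1" unfolding hit_def h1 using \<open>a < b\<close>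
      by (intro bexI[of _ "hor P (a, h1)"] exI[of _ a]) simp_all
    with \<open>j < h1\<close> show thesis using that by blast
  qed
  define T where "T = {y \<in> {j<..h1}. hit y}"
  have "finite T" unfolding T_def by (rule finite_subset[of _ "{j<..h1}"]) auto
  have "T \<noteq> {}" using h1 by (auto simp: T_def)
  define h where "h = Min T"
  have "h \<in> T" unfolding h_def using \<open>finite T\<close> \<open>T \<noteq> {}\<close> by (rule Min_in)
  then have h: "j < h" "h \<le> h1" "hit h" by (auto simp: T_def)
  have nohit: "\<not> hit y" if "j < y" "y < h" for y
    using Min_le[OF \<open>finite T\<close>, of y, folded h_def] that h(2) by (auto simp: T_def)
  have wind1: "winding u v (x, y) = 1" if "j \<le> y" "y < h" "a \<le> x" "x < b" for x y
    using that
  proof (induction y rule: int_ge_induct)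
    case base
    then show ?case using wind_bottom by blast
  next
    case (step y)
    have "winding u v (x, y + 1) = winding u v (x, y + 1 - 1)"
    proof (rule winding_across_horizontal_edge[OF P sub bal])
      fix H assume "H \<in> hor P ` u" "(x, y + 1) \<in> H"
      then have "hit (y + 1)" using step(4,5) unfolding hit_def by force
      then show "(x + 1, y + 1) \<notin> H" using nohit[of "y + 1"] step by simp
    qed
    with step show ?case by simp
  qed
  \<comment> \<open>A cell with non-zero winding number cannot lie outside the collection.\<close>
  have cells: "cell (x, y) \<in> P" if "j \<le> y" "y < h" "a \<le> x" "x < b" for x y
    using wind1[OF that] winding_outside[OF P simple sub bal, of "(x, y)"] by fastforce
  then have inner: "inner_interval P (a, j) (b, h)"
    unfolding inner_interval_iff using h(1) \<open>a < b\<close> by simp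
  obtain H x where H: "H \<in> hor P ` u" "a \<le> x" "x \<le> b" "(x, h) \<in> H" using h(3) by (auto simp: hit_def)
  then have HP: "H \<in> max_horizontal P" using hor_mem(1)[OF P] sub by auto
  have "hor P (a, h) = hor P (x, h)"
    using H(2,3) cells[of "h - 1"] h(1)
    by (intro hor_run[OF P]) (auto simp: horizontal_edge_iff[OF P])
  also have "\<dots> = H"
    using max_horizontal_subset_vertices[OF P HP] H(4) by (intro hor_eqI[OF P _ HP]) auto
  finally have "hor P (a, h) \<in> hor P ` u" using H(1) by (simp only:)
  then show thesis using that q(1) inner unfolding b by (simp only:)
qed

section \<open>Monomials modulo an ideal\<close>

text \<open>
  Any family of additive maps \<open>g k\<close> of the coefficients extends to finitely supported maps.  The
  lemma evaluates the extension on a sum of monomials even when some of them coincide or cancel.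
\<close>

lemma sum_over_keys_of_sum_of_singles:
  assumes "\<And>k. g k 0 = 0" "\<And>k a b. g k (a + b) = g k a + g k b"
  shows "(\<Sum>k\<in>Poly_Mapping.keys (\<Sum>i\<in>S. Poly_Mapping.single (t i) (c i)).
      g k (Poly_Mapping.lookup (\<Sum>i\<in>S. Poly_Mapping.single (t i) (c i)) k)) = (\<Sum>i\<in>S. g (t i) (c i))"
proof (induction S rule: infinite_finite_induct)
  case (insert i S)
  have "(\<Sum>k\<in>Poly_Mapping.keys (Poly_Mapping.single (t i) (c i)).
      g k (Poly_Mapping.lookup (Poly_Mapping.single (t i) (c i)) k)) = g (t i) (c i)"
    using assms(1) by simp
  then show ?case
    using insert by (simp add: setsum_keys_plus_distrib[of g, OF assms])
qed simp_all

lemma sum_of_singles: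
  "(\<Sum>m\<in>Poly_Mapping.keys p. Poly_Mapping.single m (Poly_Mapping.lookup p m)) = p"
  by (rule poly_mapping_eqI)
    (auto simp: lookup_sum lookup_single when_def in_keys_iff)

lemma mpoly_ring_simps [simp]:
  "x \<oplus>\<^bsub>mpoly_ring X\<^esub> y = x + y" "x \<otimes>\<^bsub>mpoly_ring X\<^esub> y = x * y"
  "\<zero>\<^bsub>mpoly_ring X\<^esub> = 0" "\<one>\<^bsub>mpoly_ring X\<^esub> = 1"
  by (simp_all add: mpoly_ring_def)

lemma carrier_mpoly_ring:
  "p \<in> carrier (mpoly_ring X) \<longleftrightarrow> (\<forall>m\<in>Poly_Mapping.keys p. Poly_Mapping.keys m \<subseteq> X)"
  by (simp add: mpoly_ring_def)

lemma mpoly_ring_closed: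
  fixes p q :: "('x, 'k::field) mpoly"
  shows "0 \<in> carrier (mpoly_ring X :: ('x, 'k) mpoly ring)"
    and "1 \<in> carrier (mpoly_ring X :: ('x, 'k) mpoly ring)"
    and "p \<in> carrier (mpoly_ring X) \<Longrightarrow> - p \<in> carrier (mpoly_ring X)"
    and "p \<in> carrier (mpoly_ring X) \<Longrightarrow> q \<in> carrier (mpoly_ring X) \<Longrightarrow> p + q \<in> carrier (mpoly_ring X)"
    and "p \<in> carrier (mpoly_ring X) \<Longrightarrow> q \<in> carrier (mpoly_ring X) \<Longrightarrow> p * q \<in> carrier (mpoly_ring X)"
proof -
  show "0 \<in> carrier (mpoly_ring X :: ('x, 'k) mpoly ring)"
    "1 \<in> carrier (mpoly_ring X :: ('x, 'k) mpoly ring)"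
    by (simp_all add: carrier_mpoly_ring)
  show "p \<in> carrier (mpoly_ring X) \<Longrightarrow> - p \<in> carrier (mpoly_ring X)"
    by (simp add: carrier_mpoly_ring in_keys_iff)
  assume pq: "p \<in> carrier (mpoly_ring X)" "q \<in> carrier (mpoly_ring X)"
  show "p + q \<in> carrier (mpoly_ring X)"
    using pq keys_add[of p q] by (auto simp: carrier_mpoly_ring)
  show "p * q \<in> carrier (mpoly_ring X)"
    unfolding carrier_mpoly_ring
  proof
    fix m assume "m \<in> Poly_Mapping.keys (p * q)"
    then obtain a b where m: "m = a + b" "a \<in> Poly_Mapping.keys p" "b \<in> Poly_Mapping.keys q"
      using keys_mult[of p q] by auto
    then have "Poly_Mapping.keys a \<subseteq> X" "Poly_Mapping.keys b \<subseteq> X"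
      using pq by (simp_all add: carrier_mpoly_ring)
    then show "Poly_Mapping.keys m \<subseteq> X" using keys_add[of a b] m(1) by auto
  qed
qed

lemma cring_mpoly_ring: "cring (mpoly_ring X :: ('x, 'k::field) mpoly ring)"
proof (rule cringI)
  show "abelian_group (mpoly_ring X :: ('x, 'k) mpoly ring)"
  proof (rule abelian_groupI)
    fix p :: "('x, 'k) mpoly" assume "p \<in> carrier (mpoly_ring X)"
    then show "\<exists>q\<in>carrier (mpoly_ring X). q \<oplus>\<^bsub>mpoly_ring X\<^esub> p = \<zero>\<^bsub>mpoly_ring X\<^esub>"
      by (intro bexI[of _ "- p"]) (simp_all add: mpoly_ring_closed)
  qed (simp_all add: mpoly_ring_closed add.assoc add.commute)
  show "Group.comm_monoid (mpoly_ring X :: ('x, 'k) mpoly ring)"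
    by (rule Group.comm_monoidI) (simp_all add: mpoly_ring_closed mult.assoc mult.commute)
qed (simp add: distrib_right)

lemma ring_mpoly_ring: "ring (mpoly_ring X :: ('x, 'k::field) mpoly ring)"
  using cring_mpoly_ring by (rule cring.axioms(1))

lemma ideal_mpoly:
  assumes "ideal I (mpoly_ring X :: ('x, 'k::field) mpoly ring)"
  shows "0 \<in> I" "p \<in> I \<Longrightarrow> q \<in> I \<Longrightarrow> p + q \<in> I"
    "p \<in> I \<Longrightarrow> Poly_Mapping.keys m \<subseteq> X \<Longrightarrow> Poly_Mapping.single m c * p \<in> I"
proof -
  interpret ideal I "mpoly_ring X :: ('x, 'k) mpoly ring" by (rule assms)
  show "0 \<in> I" using additive_subgroup.zero_closed[OF is_additive_subgroup] by simp
  show "p \<in> I \<Longrightarrow> q \<in> I \<Longrightarrow> p + q \<in> I" using additive_subgroup.a_closed[OF is_additive_subgroup, of p q] by simp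
  assume "p \<in> I" "Poly_Mapping.keys m \<subseteq> X"
  moreover from this(2) have "Poly_Mapping.single m c \<in> carrier (mpoly_ring X)"
    by (simp add: carrier_mpoly_ring)
  ultimately show "Poly_Mapping.single m c * p \<in> I"
    using I_l_closed[of p "Poly_Mapping.single m c"] by simp
qed

lemma sum_in_ideal_mpoly:
  assumes "ideal I (mpoly_ring X :: ('x, 'k::field) mpoly ring)" "\<And>i. i \<in> S \<Longrightarrow> f i \<in> I"
  shows "sum f S \<in> I"
  using assms(2)
  by (induction S rule: infinite_finite_induct) (simp_all add: ideal_mpoly(1,2)[OF assms(1)])

definition mono_cong :: "('x, 'k::field) mpoly set \<Rightarrow> ('x \<Rightarrow>\<^sub>0 nat) \<Rightarrow> ('x \<Rightarrow>\<^sub>0 nat) \<Rightarrow> bool" where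
  "mono_cong I m n \<longleftrightarrow> Poly_Mapping.single m 1 - Poly_Mapping.single n 1 \<in> I"

lemma mono_cong_refl:
  assumes "ideal I (mpoly_ring X :: ('x, 'k::field) mpoly ring)"
  shows "mono_cong I m m"
  using ideal_mpoly(1)[OF assms] by (simp add: mono_cong_def)

lemma mono_cong_sym:
  assumes "ideal I (mpoly_ring X :: ('x, 'k::field) mpoly ring)" "mono_cong I m n"
  shows "mono_cong I n m"
  using ideal_mpoly(3)[OF assms(1) assms(2)[unfolded mono_cong_def], of 0 "- 1"]
  by (simp add: mono_cong_def algebra_simps single_uminus)

lemma mono_cong_trans:
  assumes "ideal I (mpoly_ring X :: ('x, 'k::field) mpoly ring)" "mono_cong I m n" "mono_cong I n l"
  shows "mono_cong I m l"
  using ideal_mpoly(2)[OF assms(1) assms(2,3)[unfolded mono_cong_def]]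
  by (simp add: mono_cong_def)

lemma mono_cong_add_left:
  assumes "ideal I (mpoly_ring X :: ('x, 'k::field) mpoly ring)" "mono_cong I m n"
    and "Poly_Mapping.keys l \<subseteq> X"
  shows "mono_cong I (l + m) (l + n)"
  using ideal_mpoly(3)[OF assms(1) assms(2)[unfolded mono_cong_def] assms(3), of 1]
  by (simp add: mono_cong_def algebra_simps mult_single)

lemma mono_cong_add:
  assumes I: "ideal I (mpoly_ring X :: ('x, 'k::field) mpoly ring)"
    and "mono_cong I m n" "mono_cong I m' n'"
    and "Poly_Mapping.keys m' \<subseteq> X" "Poly_Mapping.keys n \<subseteq> X"
  shows "mono_cong I (m + m') (n + n')"
  using mono_cong_trans[OF I mono_cong_add_left[OF I assms(2,4)] mono_cong_add_left[OF I assms(3,5), folded add.commute[of m' n]]]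
  by (simp add: add.commute)

definition squarefree_mono :: "'x set \<Rightarrow> ('x \<Rightarrow>\<^sub>0 nat)" where
  "squarefree_mono u = (\<Sum>r\<in>u. Poly_Mapping.single r 1)"

lemma lookup_squarefree_mono:
  "finite u \<Longrightarrow> Poly_Mapping.lookup (squarefree_mono u) r = (if r \<in> u then 1 else 0)"
  by (simp add: squarefree_mono_def lookup_sum lookup_single when_def)

lemma keys_squarefree_mono: "finite u \<Longrightarrow> Poly_Mapping.keys (squarefree_mono u) = u"
  by (auto simp: in_keys_iff lookup_squarefree_mono split: if_splits)

lemma squarefree_mono_diff:
  assumes "finite u" "A \<subseteq> u"
  shows "squarefree_mono u = squarefree_mono A + squarefree_mono (u - A)"
  unfolding squarefree_mono_def using sum.subset_diff[OF assms(2,1)] by (simp add: add.commute)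


section \<open>The toric ideal as a kernel on monomials\<close>

text \<open>
  The exponent of the monomial to which \<open>\<alpha>\<close> sends the monomial with exponent \<open>m\<close>.
\<close>

definition mono_image :: "point set set \<Rightarrow> (point \<Rightarrow>\<^sub>0 nat) \<Rightarrow> (gvertex \<Rightarrow>\<^sub>0 nat)" where
  "mono_image P m = (\<Sum>r\<in>Poly_Mapping.keys m.
    Poly_Mapping.single (Inl (ver P r)) (Poly_Mapping.lookup m r) +
    Poly_Mapping.single (Inr (hor P r)) (Poly_Mapping.lookup m r))"

lemma mono_image_add: "mono_image P (m + n) = mono_image P m + mono_image P n"
  unfolding mono_image_def
  by (rule setsum_keys_plus_distrib) (simp_all add: single_add algebra_simps)

text \<open>
  Both images are the product of all nodes of the cycles, each to the first power.
\<close>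

lemma mono_image_squarefree_mono:
  assumes "balanced (ver P) (hor P) u v"
  shows "mono_image P (squarefree_mono u) = mono_image P (squarefree_mono v)"
proof -
  have *: "mono_image P (squarefree_mono w) =
      (\<Sum>V\<in>ver P ` w. Poly_Mapping.single (Inl V) 1) + (\<Sum>H\<in>hor P ` w. Poly_Mapping.single (Inr H) 1)"
    if "finite w" "inj_on (ver P) w" "inj_on (hor P) w" for w
    using that
    by (simp add: mono_image_def keys_squarefree_mono lookup_squarefree_mono sum.distrib sum.reindex)
  show ?thesis using assms by (simp add: balanced_def *)
qed

lemma keys_mono_image:
  "Poly_Mapping.keys (mono_image P m) =
    ver P ` Poly_Mapping.keys m <+> hor P ` Poly_Mapping.keys m"
proof (rule Set.set_eqI)
  fix k :: gvertex
  have "k \<in> Poly_Mapping.keys (mono_image P m) \<longleftrightarrow>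
      (\<exists>r\<in>Poly_Mapping.keys m. k = Inl (ver P r) \<or> k = Inr (hor P r))"
    unfolding in_keys_iff[of k] mono_image_def lookup_sum lookup_add lookup_single when_def
    by (auto simp: in_keys_iff)
  then show "k \<in> Poly_Mapping.keys (mono_image P m) \<longleftrightarrow>
      k \<in> ver P ` Poly_Mapping.keys m <+> hor P ` Poly_Mapping.keys m"
    by auto
qed

lemma prod_of_single_monomials:
  "(\<Prod>i\<in>S. Poly_Mapping.single (t i) (1::'k::field)) = Poly_Mapping.single (\<Sum>i\<in>S. t i :: 'x \<Rightarrow>\<^sub>0 nat) 1"
  by (induction S rule: infinite_finite_induct) (simp_all add: mult_single)

lemma alpha_power:
  "alpha P r ^ n = (Poly_Mapping.single (Poly_Mapping.single (Inl (ver P r)) n +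
    Poly_Mapping.single (Inr (hor P r)) n) 1 :: (gvertex, 'k::field) mpoly)"
proof (induction n)
  case (Suc n)
  have "alpha P r = (Poly_Mapping.single (Poly_Mapping.single (Inl (ver P r)) 1 +
    Poly_Mapping.single (Inr (hor P r)) 1) 1 :: (gvertex, 'k) mpoly)"
    by (simp add: alpha_def ver_def hor_def Var_def mult_single)
  then show ?case using Suc
    by (simp add: mult_single single_add[of _ 1 n, simplified] algebra_simps)
qed simp

lemma mpoly_hom_alpha:
  "(mpoly_hom (alpha P) p :: (gvertex, 'k::field) mpoly) =
    (\<Sum>m\<in>Poly_Mapping.keys p. Poly_Mapping.single (mono_image P m) (Poly_Mapping.lookup p m))"
  unfolding mpoly_hom_def alpha_power prod_of_single_monomials mono_image_def[symmetric]
  by (simp add: Const_def mult_single)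

lemma mpoly_hom_alpha_add:
  "mpoly_hom (alpha P) (p + q) = (mpoly_hom (alpha P) p + mpoly_hom (alpha P) q :: (gvertex, 'k::field) mpoly)"
  unfolding mpoly_hom_alpha by (rule setsum_keys_plus_distrib) (simp_all add: single_add)

lemma mpoly_hom_alpha_single:
  "mpoly_hom (alpha P) (Poly_Mapping.single m c) =
    (Poly_Mapping.single (mono_image P m) c :: (gvertex, 'k::field) mpoly)"
  by (simp add: mpoly_hom_alpha)

lemma mpoly_hom_alpha_mult:
  "mpoly_hom (alpha P) (p * q) = (mpoly_hom (alpha P) p * mpoly_hom (alpha P) q :: (gvertex, 'k::field) mpoly)"
proof -
  let ?l = Poly_Mapping.lookup
  have "p * q = (\<Sum>m\<in>Poly_Mapping.keys p. Poly_Mapping.single m (?l p m)) *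
      (\<Sum>n\<in>Poly_Mapping.keys q. Poly_Mapping.single n (?l q n))"
    by (simp only: sum_of_singles)
  also have "\<dots> = (\<Sum>z\<in>Poly_Mapping.keys p \<times> Poly_Mapping.keys q.
      Poly_Mapping.single (fst z + snd z) (?l p (fst z) * ?l q (snd z)))"
    by (simp add: sum_product sum.cartesian_product mult_single case_prod_beta)
  finally have "mpoly_hom (alpha P) (p * q) = (\<Sum>z\<in>Poly_Mapping.keys p \<times> Poly_Mapping.keys q.
      Poly_Mapping.single (mono_image P (fst z + snd z)) (?l p (fst z) * ?l q (snd z)))"
    unfolding mpoly_hom_alpha
    using sum_over_keys_of_sum_of_singles[of "\<lambda>m c. Poly_Mapping.single (mono_image P m) c"]
    by (simp add: single_add)
  also have "\<dots> = mpoly_hom (alpha P) p * mpoly_hom (alpha P) q"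
    unfolding mpoly_hom_alpha
    by (simp add: sum_product sum.cartesian_product mult_single case_prod_beta mono_image_add)
  finally show ?thesis .
qed

lemma toric_ideal_eq:
  "toric_ideal P = {p \<in> carrier (mpoly_ring (vertices P)). mpoly_hom (alpha P) p = 0}"
  by (simp add: toric_ideal_def a_kernel_def' edge_ring_def gen_subalgebra_def)

text \<open>
  The homomorphism is regarded as one into the full polynomial ring of the graph variables rather than
  into the edge ring; its kernel remains the same.
\<close>

lemma ideal_toric_ideal:
  "ideal (toric_ideal P) (mpoly_ring (vertices P) :: (point, 'k::field) mpoly ring)"
proof -
  let ?R = "mpoly_ring (vertices P) :: (point, 'k) mpoly ring"
  let ?S = "mpoly_ring UNIV :: (gvertex, 'k) mpoly ring"
  have "mpoly_hom (alpha P) 1 = (1 :: (gvertex, 'k) mpoly)"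
    using mpoly_hom_alpha_single[of P 0 1] by (simp add: mono_image_def)
  then have "mpoly_hom (alpha P) \<in> ring_hom ?R ?S"
    by (intro ring_hom_memI)
      (simp_all add: carrier_mpoly_ring mpoly_hom_alpha_add mpoly_hom_alpha_mult)
  then have "ring_hom_ring ?R ?S (mpoly_hom (alpha P))"
    by (rule ring_hom_ringI2[OF ring_mpoly_ring ring_mpoly_ring])
  then have "ideal (a_kernel ?R ?S (mpoly_hom (alpha P))) ?R"
    by (rule ring_hom_ring.kernel_is_ideal)
  then show ?thesis by (simp add: toric_ideal_eq a_kernel_def')
qed

section \<open>Monomials modulo the inner minors\<close>

lemma ideal_inner_minor_ideal:
  assumes P: "cell_collection P"
  shows "ideal (inner_minor_ideal P) (mpoly_ring (vertices P) :: (point, 'k::field) mpoly ring)"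
    and "inner_minors P \<subseteq> (inner_minor_ideal P :: (point, 'k::field) mpoly set)"
proof -
  have *: "Var r * Var s \<in> carrier (mpoly_ring (vertices P) :: (point, 'k) mpoly ring)"
    if "r \<in> vertices P" "s \<in> vertices P" for r s
    using that by (intro mpoly_ring_closed) (simp_all add: Var_def carrier_mpoly_ring)
  have "inner_minors P \<subseteq> carrier (mpoly_ring (vertices P) :: (point, 'k) mpoly ring)"
  proof
    fix p :: "(point, 'k) mpoly" assume "p \<in> inner_minors P"
    then obtain i j k l where p: "p = Var (i, j) * Var (k, l) - Var (i, l) * Var (k, j)"
      and "inner_interval P (i, j) (k, l)" by (auto simp: inner_minors_def)
    from inner_interval_corners(1)[OF P this(2)]
    have "Var (i, j) * Var (k, l) + - (Var (i, l) * Var (k, j)) \<in>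
        carrier (mpoly_ring (vertices P) :: (point, 'k) mpoly ring)"
      by (intro mpoly_ring_closed(3,4) *) auto
    then show "p \<in> carrier (mpoly_ring (vertices P))" by (simp add: p)
  qed
  then show "ideal (inner_minor_ideal P) (mpoly_ring (vertices P) :: (point, 'k) mpoly ring)"
    "inner_minors P \<subseteq> (inner_minor_ideal P :: (point, 'k) mpoly set)"
    unfolding inner_minor_ideal_def
    by (rule ring.genideal_ideal[OF ring_mpoly_ring], rule ring.genideal_self[OF ring_mpoly_ring])
qed

lemma inner_minors_subset_toric_ideal:
  assumes P: "cell_collection P"
  shows "inner_minors P \<subseteq> (toric_ideal P :: (point, 'k::field) mpoly set)"
proof
  fix p :: "(point, 'k) mpoly" assume p_in: "p \<in> inner_minors P"
  then have "p \<in> inner_minor_ideal P" using ideal_inner_minor_ideal(2)[OF P] by blast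
  then have "p \<in> carrier (mpoly_ring (vertices P))"
    using ideal.Icarr[OF ideal_inner_minor_ideal(1)[OF P]] by blast
  moreover obtain i j k l where p: "p = Var (i, j) * Var (k, l) - Var (i, l) * Var (k, j)"
    and I: "inner_interval P (i, j) (k, l)" using p_in by (auto simp: inner_minors_def)
  have h: "mpoly_hom (alpha P) (a - b) = (mpoly_hom (alpha P) a - mpoly_hom (alpha P) b :: (gvertex, 'k) mpoly)"
    for a b :: "(point, 'k) mpoly"
    using mpoly_hom_alpha_add[of P "a - b" b] by (simp add: algebra_simps)
  have "mpoly_hom (alpha P) p = (0 :: (gvertex, 'k) mpoly)"
    unfolding p h mpoly_hom_alpha_mult mpoly_hom_Var alpha_def
    unfolding ver_def[symmetric] hor_def[symmetric] inner_interval_corners(2-5)[OF P I]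
    by (simp add: algebra_simps)
  ultimately show "p \<in> toric_ideal P" by (simp add: toric_ideal_eq)
qed

lemma mono_cong_inner_interval:
  assumes P: "cell_collection P" and I: "inner_interval P (a, j) (b, h)"
  shows "mono_cong (inner_minor_ideal P :: (point, 'k::field) mpoly set)
    (squarefree_mono {(a, j), (b, h)}) (squarefree_mono {(b, j), (a, h)})"
proof -
  have neq: "(a, j) \<noteq> (b, h)" "(b, j) \<noteq> (a, h)" using I by (auto simp: inner_interval_iff)
  have "Var (a, j) * Var (b, h) - Var (a, h) * Var (b, j) \<in> (inner_minors P :: (point, 'k) mpoly set)"
    unfolding inner_minors_def using I by blast
  then have "Var (a, j) * Var (b, h) - Var (a, h) * Var (b, j) \<in>
      (inner_minor_ideal P :: (point, 'k) mpoly set)"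
    using ideal_inner_minor_ideal(2)[OF P] by blast
  then show ?thesis
    using neq by (simp add: mono_cong_def squarefree_mono_def Var_def mult_single add.commute)
qed

lemma mono_cong_squarefree_parts:
  assumes I: "ideal I (mpoly_ring X :: ('x, 'k::field) mpoly ring)"
    and "finite u" "u \<subseteq> X" "finite v" "v \<subseteq> X" "A \<subseteq> u" "B \<subseteq> v"
    and "mono_cong I (squarefree_mono A) (squarefree_mono B)"
    and "mono_cong I (squarefree_mono (u - A)) (squarefree_mono (v - B))"
  shows "mono_cong I (squarefree_mono u) (squarefree_mono v)"
proof -
  have "finite B" using assms(4,7) by (rule finite_subset[rotated])
  have "mono_cong I (squarefree_mono A + squarefree_mono (u - A))
      (squarefree_mono B + squarefree_mono (v - B))"
    using assms \<open>finite B\<close>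
    by (intro mono_cong_add[OF I]) (auto simp: keys_squarefree_mono)
  then show ?thesis
    unfolding squarefree_mono_diff[OF assms(2,6)] squarefree_mono_diff[OF assms(4,7)] .
qed

text \<open>
  Let the chord \<open>r\<close> split the cycle into \<open>(A, B \<union> {r})\<close> and \<open>((u - A) \<union> {r}, v - B)\<close>.  The induction
  hypothesis for the first pair turns the monomial of \<open>u\<close> into that of \<open>B\<close>, \<open>r\<close> and \<open>u - A\<close>; for the
  second pair it turns this monomial into that of \<open>v\<close>.
\<close>

lemma mono_cong_chord:
  fixes I :: "(point, 'k::field) mpoly set"
  assumes P: "cell_collection P" and I: "ideal I (mpoly_ring (vertices P))"
    and IH: "\<And>u' v'. card u' < card u \<Longrightarrow> u' \<subseteq> vertices P \<Longrightarrow> v' \<subseteq> vertices P \<Longrightarrow>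
      balanced (ver P) (hor P) u' v' \<Longrightarrow> mono_cong I (squarefree_mono u') (squarefree_mono v')"
    and sub: "u \<subseteq> vertices P" "v \<subseteq> vertices P" and bal: "balanced (ver P) (hor P) u v"
    and r: "r \<in> vertices P" "ver P r \<in> ver P ` u" "hor P r \<in> hor P ` u" "r \<notin> u" "r \<notin> v"
  shows "mono_cong I (squarefree_mono u) (squarefree_mono v)"
proof -
  have fin: "finite u" "finite v" using bal by (auto simp: balanced_def)
  have "inj_on (\<lambda>x. (ver P x, hor P x)) (insert r (u \<union> v))"
    using inj_on_ver_hor[OF P] by (rule inj_on_subset) (use sub r(1) in simp)
  with bal r(2-5) show ?thesis
  proof (cases rule: balanced_chord)
    case (cycle A B)
    have "card A < card u" using cycle(1,3) fin(1) by (intro psubset_card_mono) auto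
    moreover have "card (u - A) < card u" using cycle(1,2) fin(1) by (intro psubset_card_mono) auto
    ultimately show ?thesis
      using cycle sub balanced_diff[OF bal cycle(5,1,4)]
      by (intro mono_cong_squarefree_parts[OF I fin(1) sub(1) fin(2) sub(2) cycle(1,4)] IH) auto
  next
    case (split A B)
    have cA: "card A < card u" using split(1,2) fin(1) by (intro psubset_card_mono) auto
    have finA: "finite A" and finB: "finite B" using split(1,3) fin finite_subset by blast+
    have "r \<notin> B" using split(3) r(5) by blast
    have 1: "mono_cong I (squarefree_mono A) (squarefree_mono (insert r B))"
      using split sub r(1) cA by (intro IH) auto
    have 2: "mono_cong I (squarefree_mono (insert r (u - A))) (squarefree_mono (v - B))"
      using split sub r(1) by (intro IH) auto
    have "mono_cong I (squarefree_mono A + squarefree_mono (u - A))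
        (squarefree_mono (insert r B) + squarefree_mono (u - A))"
      using mono_cong_add_left[OF I 1, of "squarefree_mono (u - A)"] fin(1) sub(1)
      by (auto simp: keys_squarefree_mono add.commute)
    also have "squarefree_mono (insert r B) + squarefree_mono (u - A) =
        squarefree_mono B + squarefree_mono (insert r (u - A))"
      using finB fin(1) \<open>r \<notin> B\<close> r(4) by (simp add: squarefree_mono_def add_ac)
    finally have "mono_cong I (squarefree_mono u) (squarefree_mono B + squarefree_mono (insert r (u - A)))"
      by (simp only: squarefree_mono_diff[OF fin(1) split(1)])
    moreover have "mono_cong I (squarefree_mono B + squarefree_mono (insert r (u - A)))
        (squarefree_mono B + squarefree_mono (v - B))"
      using split(3) sub(2) finB by (intro mono_cong_add_left[OF I 2]) (auto simp: keys_squarefree_mono)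
    ultimately show ?thesis
      unfolding squarefree_mono_diff[OF fin(2) split(3)] by (rule mono_cong_trans[OF I])
  qed
qed

text \<open>
  Both upper corners of the rectangle found at the lowest corner are edges between nodes of the cycle.
  If one of them is not on the cycle, it is a chord.  Otherwise the four corners of the rectangle
  are a cycle of length four, and the corresponding inner minor removes it.
\<close>

lemma mono_cong_lowest_corner:
  assumes P: "cell_collection P" and simple: "simple_collection P"
    and IH: "\<And>u' v'. card u' < card u \<Longrightarrow> u' \<subseteq> vertices P \<Longrightarrow> v' \<subseteq> vertices P \<Longrightarrow>
      balanced (ver P) (hor P) u' v' \<Longrightarrow>
      mono_cong (inner_minor_ideal P :: (point, 'k::field) mpoly set) (squarefree_mono u') (squarefree_mono v')"
    and sub: "u \<subseteq> vertices P" "v \<subseteq> vertices P" and bal: "balanced (ver P) (hor P) u v"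
    and disj: "u \<inter> v = {}" and p: "(a, j) \<in> u"
    and low: "\<And>s. s \<in> u \<union> v \<Longrightarrow> j < snd s \<or> snd s = j \<and> a \<le> fst s"
  shows "mono_cong (inner_minor_ideal P :: (point, 'k::field) mpoly set) (squarefree_mono u) (squarefree_mono v)"
proof -
  note I = ideal_inner_minor_ideal(1)[OF P, where ?'k = 'k]
  have fin: "finite u" "finite v" and inj: "inj_on (ver P) u" "inj_on (ver P) v"
      "inj_on (hor P) u" "inj_on (hor P) v"
    and img: "ver P ` u = ver P ` v" "hor P ` u = hor P ` v"
    using bal by (auto simp: balanced_def)
  obtain b h where q: "(b, j) \<in> v" and inner: "inner_interval P (a, j) (b, h)"
    and hit: "hor P (a, h) \<in> hor P ` u"
    using inner_rectangle_at_lowest_corner[OF P simple sub bal disj p low] .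
  note corners = inner_interval_corners[OF P inner]
  have vr: "ver P (a, h) \<in> ver P ` u" unfolding corners(2) using p by (rule imageI)
  have vr': "ver P (b, h) \<in> ver P ` u" unfolding corners(3) img(1) using q by (rule imageI)
  have hit': "hor P (b, h) \<in> hor P ` u" unfolding corners(5) by (rule hit)
  have r_vert: "(a, h) \<in> vertices P" "(b, h) \<in> vertices P" using corners(1) by simp_all
  have "a \<noteq> b" "j \<noteq> h" using inner by (auto simp: inner_interval_iff)
  consider "(a, h) \<notin> u \<union> v" | "(b, h) \<notin> u \<union> v" | "(a, h) \<in> u \<union> v" "(b, h) \<in> u \<union> v" by blast
  then show ?thesis
  proof cases
    case 1
    then show ?thesis
      by (intro mono_cong_chord[OF P I IH sub bal r_vert(1) vr hit]) simp_all
  next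
    case 2
    then show ?thesis
      by (intro mono_cong_chord[OF P I IH sub bal r_vert(2) vr' hit']) simp_all
  next
    case 3
    have "(a, h) \<notin> u" using inj_onD[OF inj(1) corners(2) _ p] \<open>j \<noteq> h\<close> by auto
    then have r: "(a, h) \<in> v" using 3(1) by simp
    have "(b, h) \<notin> v" using inj_onD[OF inj(2) corners(3) _ q] \<open>j \<noteq> h\<close> by auto
    then have r': "(b, h) \<in> u" using 3(2) by simp
    let ?A = "{(a, j), (b, h)}" and ?B = "{(b, j), (a, h)}"
    have AB: "?A \<subseteq> u" "?B \<subseteq> v" using p q r r' by simp_all
    have "ver P ` ?A = ver P ` ?B" "hor P ` ?A = hor P ` ?B"
      using corners(2-5) by auto
    then have balAB: "balanced (ver P) (hor P) ?A ?B"
      unfolding balanced_def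
      using inj_on_subset[OF inj(1) AB(1)] inj_on_subset[OF inj(2) AB(2)]
        inj_on_subset[OF inj(3) AB(1)] inj_on_subset[OF inj(4) AB(2)] by simp
    have "card (u - ?A) < card u" using p fin(1) by (intro psubset_card_mono) auto
    then have "mono_cong (inner_minor_ideal P :: (point, 'k) mpoly set)
        (squarefree_mono (u - ?A)) (squarefree_mono (v - ?B))"
      using sub by (intro IH balanced_diff[OF bal balAB AB]) auto
    then show ?thesis
      by (rule mono_cong_squarefree_parts[OF I fin(1) sub(1) fin(2) sub(2) AB
            mono_cong_inner_interval[OF P inner]])
  qed
qed

lemma lowest_leftmost_point:
  fixes S :: "point set"
  assumes "finite S" "S \<noteq> {}"
  obtains a j where "(a, j) \<in> S" "\<And>s. s \<in> S \<Longrightarrow> j < snd s \<or> snd s = j \<and> a \<le> fst s"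
proof -
  define j where "j = Min (snd ` S)"
  define R where "R = {s \<in> S. snd s = j}"
  have "j \<in> snd ` S" unfolding j_def using assms by (intro Min_in) auto
  then have R: "finite R" "R \<noteq> {}" using assms by (auto simp: R_def)
  define a where "a = Min (fst ` R)"
  have "a \<in> fst ` R" unfolding a_def using R by (intro Min_in) auto
  then have "(a, j) \<in> S" by (auto simp: R_def)
  moreover have "j < snd s \<or> snd s = j \<and> a \<le> fst s" if "s \<in> S" for s
  proof -
    have "j \<le> snd s" unfolding j_def using assms that by (intro Min_le) auto
    moreover have "a \<le> fst s" if "snd s = j"
      unfolding a_def using R \<open>s \<in> S\<close> that by (intro Min_le) (auto simp: R_def)
    ultimately show ?thesis by linarith
  qed
  ultimately show thesis by (rule that)
qed

text \<open>
  Points common to \<open>u\<close> and \<open>v\<close> are cancelled.  Then the leftmost among the lowest points is a corner of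
  the curve; after exchanging the two sets if necessary, it belongs to \<open>u\<close>.
\<close>

lemma mono_cong_balanced:
  assumes P: "cell_collection P" and simple: "simple_collection P"
    and "u \<subseteq> vertices P" "v \<subseteq> vertices P" "balanced (ver P) (hor P) u v"
  shows "mono_cong (inner_minor_ideal P :: (point, 'k::field) mpoly set) (squarefree_mono u) (squarefree_mono v)"
  using assms(3-5)
proof (induction "card u" arbitrary: u v rule: less_induct)
  case less
  note I = ideal_inner_minor_ideal(1)[OF P, where ?'k = 'k]
  note IH = less(1) and sub = less(2,3) and bal = less(4)
  have fin: "finite u" "finite v" using bal by (auto simp: balanced_def)
  consider "u = {}" | c where "c \<in> u" "c \<in> v" | "u \<inter> v = {}" "u \<noteq> {}" by blast
  then show ?case
  proof cases
    case 1
    then have "v = {}" using bal by (simp add: balanced_def)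
    with 1 show ?thesis using mono_cong_refl[OF I] by simp
  next
    case (2 c)
    then have cs: "{c} \<subseteq> u" "{c} \<subseteq> v" by simp_all
    have "card (u - {c}) < card u" using 2(1) fin(1) by (intro psubset_card_mono) auto
    then have "mono_cong (inner_minor_ideal P :: (point, 'k) mpoly set)
        (squarefree_mono (u - {c})) (squarefree_mono (v - {c}))"
      using sub by (intro IH balanced_diff[OF bal balanced_singleton cs]) auto
    then show ?thesis
      by (rule mono_cong_squarefree_parts[OF I fin(1) sub(1) fin(2) sub(2) cs mono_cong_refl[OF I]])
  next
    case 3
    obtain a j where aj: "(a, j) \<in> u \<union> v"
      "\<And>s. s \<in> u \<union> v \<Longrightarrow> j < snd s \<or> snd s = j \<and> a \<le> fst s"
      using lowest_leftmost_point[of "u \<union> v"] fin 3(2) by auto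
    show ?thesis
    proof (cases "(a, j) \<in> u")
      case True
      then show ?thesis
        by (intro mono_cong_lowest_corner[OF P simple IH sub bal 3(1) _ aj(2)])
    next
      case False
      then have "(a, j) \<in> v" using aj(1) by simp
      then have "mono_cong (inner_minor_ideal P :: (point, 'k) mpoly set)
          (squarefree_mono v) (squarefree_mono u)"
        using IH balanced_card[OF bal] aj(2) 3(1) sub balanced_sym[OF bal]
        by (intro mono_cong_lowest_corner[OF P simple, of v u a j]) (auto simp: Int_commute)
      then show ?thesis by (rule mono_cong_sym[OF I])
    qed
  qed
qed

text \<open>
  Two monomials with the same image give two multisets of edges with the same degree at every node.
  Unless they are empty they contain a balanced pair, and replacing one half of it by the other makes
  this part of the two monomials agree; the rest has the same image and smaller degree.
\<close>

lemma mono_cong_of_equal_image: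
  assumes P: "cell_collection P" and simple: "simple_collection P"
    and "Poly_Mapping.keys m \<subseteq> vertices P" "Poly_Mapping.keys n \<subseteq> vertices P"
    and "mono_image P m = mono_image P n"
  shows "mono_cong (inner_minor_ideal P :: (point, 'k::field) mpoly set) m n"
  using assms(3-5)
proof (induction "\<Sum>r\<in>Poly_Mapping.keys m. Poly_Mapping.lookup m r" arbitrary: m n rule: less_induct)
  case less
  note I = ideal_inner_minor_ideal(1)[OF P, where ?'k = 'k]
  let ?u = "Poly_Mapping.keys m" and ?v = "Poly_Mapping.keys n"
  note sub = less(2,3)
  have preimages: "ver P ` Poly_Mapping.keys l = Inl -` Poly_Mapping.keys (mono_image P l)"
    "hor P ` Poly_Mapping.keys l = Inr -` Poly_Mapping.keys (mono_image P l)" for l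
    unfolding keys_mono_image by auto
  have img: "ver P ` ?u = ver P ` ?v" "hor P ` ?u = hor P ` ?v"
    unfolding preimages less(4) by simp_all
  show ?case
  proof (cases "m = 0")
    case True
    then have "?v = {}" using img(1) by simp
    then have "n = 0" by (intro poly_mapping_eqI) (simp add: not_in_keys_iff_lookup_eq_zero[symmetric])
    with True show ?thesis using mono_cong_refl[OF I] by simp
  next
    case False
    then have "?u \<noteq> {}" by (metis empty_iff lookup_zero not_in_keys_iff_lookup_eq_zero poly_mapping_eqI)
    then obtain A B where AB: "A \<subseteq> ?u" "A \<noteq> {}" "B \<subseteq> ?v" "balanced (ver P) (hor P) A B"
      using balanced_subsets_of_equal_images[of ?u ?v "hor P" "ver P"] img by auto
    have fin: "finite A" "finite B" using AB(4) by (simp_all add: balanced_def)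
    define m' where "m' = m - squarefree_mono A"
    define n' where "n' = n - squarefree_mono B"
    have m: "m = squarefree_mono A + m'"
      using AB(1) fin(1)
      by (intro poly_mapping_eqI) (auto simp: m'_def lookup_add lookup_minus lookup_squarefree_mono in_keys_iff)
    have n: "n = squarefree_mono B + n'"
      using AB(3) fin(2)
      by (intro poly_mapping_eqI) (auto simp: n'_def lookup_add lookup_minus lookup_squarefree_mono in_keys_iff)
    have "mono_image P m' = mono_image P n'"
      using less(4) mono_image_squarefree_mono[OF AB(4)] unfolding m n mono_image_add by simp
    moreover have keys: "Poly_Mapping.keys m' \<subseteq> ?u" "Poly_Mapping.keys n' \<subseteq> ?v"
      by (auto simp: m'_def n'_def in_keys_iff lookup_minus)
    moreover have "(\<Sum>r\<in>Poly_Mapping.keys m'. Poly_Mapping.lookup m' r) <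
        (\<Sum>r\<in>Poly_Mapping.keys m. Poly_Mapping.lookup m r)"
    proof -
      have "(\<Sum>r\<in>Poly_Mapping.keys m. Poly_Mapping.lookup m r) =
          (\<Sum>r\<in>A. Poly_Mapping.lookup (squarefree_mono A) r) +
          (\<Sum>r\<in>Poly_Mapping.keys m'. Poly_Mapping.lookup m' r)"
        using setsum_keys_plus_distrib[of "\<lambda>_ c. c" "squarefree_mono A" m']
        unfolding m[symmetric] by (simp add: keys_squarefree_mono[OF fin(1)])
      moreover have "(\<Sum>r\<in>A. Poly_Mapping.lookup (squarefree_mono A) r) = card A"
        using fin(1) by (simp add: lookup_squarefree_mono)
      ultimately show ?thesis using AB(2) fin(1) by (simp add: card_gt_0_iff)
    qed
    ultimately have "mono_cong (inner_minor_ideal P :: (point, 'k) mpoly set) m' n'"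
      using sub by (intro less(1)) auto
    moreover have "mono_cong (inner_minor_ideal P :: (point, 'k) mpoly set)
        (squarefree_mono A) (squarefree_mono B)"
      using AB sub by (intro mono_cong_balanced[OF P simple]) auto
    ultimately show ?thesis
      unfolding m n using AB(3) sub keys fin
      by (intro mono_cong_add[OF I]) (auto simp: keys_squarefree_mono)
  qed
qed

theorem theorem3p3:
  fixes P :: "point set set"
  assumes "cell_collection P"
    and "weakly_connected P"
    and "simple_collection P"
  shows "(inner_minor_ideal P :: (point, 'k::field) mpoly set) = toric_ideal P"
proof
  note P = assms(1) and simple = assms(3)
  let ?I = "inner_minor_ideal P :: (point, 'k) mpoly set"
  note I = ideal_inner_minor_ideal(1)[OF P, where ?'k = 'k]
  show "?I \<subseteq> toric_ideal P"
    unfolding inner_minor_ideal_def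
    by (rule ring.genideal_minimal[OF ring_mpoly_ring ideal_toric_ideal inner_minors_subset_toric_ideal[OF P]])
  show "toric_ideal P \<subseteq> ?I"
  proof
    fix p :: "(point, 'k) mpoly"
    assume "p \<in> toric_ideal P"
    then have p: "\<And>m. m \<in> Poly_Mapping.keys p \<Longrightarrow> Poly_Mapping.keys m \<subseteq> vertices P"
      and ker: "mpoly_hom (alpha P) p = 0"
      by (auto simp: toric_ideal_eq carrier_mpoly_ring)
    \<comment> \<open>Replacing each monomial by a representative of its fibre factors through the homomorphism,
      and so it sends the kernel to zero.\<close>
    define rep where
      "rep t = (SOME m. Poly_Mapping.keys m \<subseteq> vertices P \<and> mono_image P m = t)" for t
    have rep: "Poly_Mapping.keys (rep (mono_image P m)) \<subseteq> vertices P"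
      "mono_image P (rep (mono_image P m)) = mono_image P m" if "m \<in> Poly_Mapping.keys p" for m
      using someI[of "\<lambda>m'. Poly_Mapping.keys m' \<subseteq> vertices P \<and> mono_image P m' = mono_image P m" m]
        p[OF that] unfolding rep_def by simp_all
    let ?c = "Poly_Mapping.lookup p"
    have "(\<Sum>m\<in>Poly_Mapping.keys p. Poly_Mapping.single (rep (mono_image P m)) (?c m)) = 0"
      using sum_over_keys_of_sum_of_singles[of "\<lambda>t. Poly_Mapping.single (rep t)" "mono_image P" ?c "Poly_Mapping.keys p"]
      unfolding mpoly_hom_alpha[symmetric] ker by (simp add: single_add)
    then have "p = (\<Sum>m\<in>Poly_Mapping.keys p. Poly_Mapping.single m (?c m)) -
        (\<Sum>m\<in>Poly_Mapping.keys p. Poly_Mapping.single (rep (mono_image P m)) (?c m))"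
      by (simp add: sum_of_singles)
    also have "\<dots> = (\<Sum>m\<in>Poly_Mapping.keys p. Poly_Mapping.single 0 (?c m) *
        (Poly_Mapping.single m 1 - Poly_Mapping.single (rep (mono_image P m)) 1))"
      by (simp add: sum_subtractf right_diff_distrib mult_single)
    also have "\<dots> \<in> ?I"
    proof (rule sum_in_ideal_mpoly[OF I])
      fix m assume m: "m \<in> Poly_Mapping.keys p"
      have "mono_cong ?I m (rep (mono_image P m))"
        by (rule mono_cong_of_equal_image[OF P simple p[OF m] rep(1)[OF m] rep(2)[OF m, symmetric]])
      then show "Poly_Mapping.single 0 (?c m) *
          (Poly_Mapping.single m 1 - Poly_Mapping.single (rep (mono_image P m)) 1) \<in> ?I"
        unfolding mono_cong_def by (intro ideal_mpoly(3)[OF I]) simp_all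
    qed
    finally show "p \<in> ?I" .
  qed
qed

end
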